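(* Let $n\ge1$ be an integer and $\mathcal{Y}$ a Hilbert space. A Hilbert space $\mathcal{M}$ satisfies the three conditions (1) $\mathcal{M}$ is contractively included in $\mathcal{A}_n(\mathcal{Y})$, i.e. $\mathcal{M}\subset\mathcal{A}_n(\mathcal{Y})$ with $\|f\|_{\mathcal{A}_n(\mathcal{Y})}\le\|f\|_{\mathcal{M}}$ for all $f\in\mathcal{M}$; (2) $\mathcal{M}$ is $S_n$-invariant: $S_n\mathcal{M}\subset\mathcal{M}$; (3) the operator $A=(S_n|_{\mathcal{M}})^*$ (adjoint taken with respect to the inner product of $\mathcal{M}$) is a strongly stable $n$-hypercontraction; if and only if there exist a Hilbert space $\mathcal{U}$ and a contractive multiplier $\Theta$ (an $\mathcal{L}(\mathcal{U},\mathcal{Y})$-valued function such that $M_\Theta:f(z)\mapsto\Theta(z)f(z)$ is a contraction from $\mathcal{A}_n(\mathcal{U})$ to $\mathcal{A}_n(\mathcal{Y})$) such that $$\mathcal{M}=\Theta\cdot\mathcal{A}_n(\mathcal{U})\quad\text{with lifted norm}\quad\|\Theta f\|_{\mathcal{M}}=\|Qf\|_{\mathcal{A}_n(\mathcal{U})}\quad (f\in\mathcal{A}_n(\mathcal{U})),$$ where $Q$ is the orthogonal projection of $\mathcal{A}_n(\mathcal{U})$ onto $(\operatorname{Ker}M_\Theta)^\perp$.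
   Context: For an integer $n\ge1$ and a Hilbert space $\mathcal{Y}$, $\mathcal{A}_n(\mathcal{Y})$ is the Hilbert space of $\mathcal{Y}$-valued functions $f(z)=\sum_{j\ge0}f_jz^j$ analytic on the open unit disk $\mathbb{D}$ with $\|f\|^2=\sum_{j\ge0}\mu_{n,j}\|f_j\|^2<\infty$, where $\mu_{n,j}=1/\binom{n+j-1}{j}$; $S_n$ is the shift $f(z)\mapsto zf(z)$ on $\mathcal{A}_n(\mathcal{Y})$. A bounded operator $A$ on a Hilbert space is strongly stable if $\|A^kx\|\to0$ as $k\to\infty$ for every $x$. It is an $n$-hypercontraction if $\sum_{j=0}^k(-1)^j\binom{k}{j}A^{*j}A^j\ge0$ for all $0\le k\le n$. *)

theory Defs
  imports "HOL-Analysis.Analysis" "HOL-Library.Function_Algebras"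
begin

class complex_vector = ab_group_add +
  fixes scaleC :: "complex \<Rightarrow> 'a \<Rightarrow> 'a"  (infixr "*\<^sub>C" 75)
  assumes scaleC_add_right: "c *\<^sub>C (x + y) = c *\<^sub>C x + c *\<^sub>C y"
    and scaleC_add_left: "(c + d) *\<^sub>C x = c *\<^sub>C x + d *\<^sub>C x"
    and scaleC_scaleC: "c *\<^sub>C (d *\<^sub>C x) = (c * d) *\<^sub>C x"
    and scaleC_one: "1 *\<^sub>C x = x"

global_interpretation complex_vector: vector_space "scaleC :: complex \<Rightarrow> 'a \<Rightarrow> 'a::complex_vector"
  by unfold_locales (rule scaleC_add_right scaleC_add_left scaleC_scaleC scaleC_one)+

instantiation "fun" :: (type, complex_vector) complex_vector
begin

definition scaleC_fun :: "complex \<Rightarrow> ('a \<Rightarrow> 'b) \<Rightarrow> 'a \<Rightarrow> 'b"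
  where "c *\<^sub>C f = (\<lambda>x. c *\<^sub>C f x)"

instance
  by standard
    (auto simp: scaleC_fun_def fun_eq_iff scaleC_add_right scaleC_add_left scaleC_scaleC scaleC_one)

end

text \<open>
  A Hilbert space is given by a linear subspace of an ambient complex vector space together with
  a form on it.  It has to carry its own inner product, since a space contractively included in
  another one is not a closed subspace of it; and it has to be a term rather than a type so that
  Hilbert spaces can be quantified existentially.  Values of the form off the subspace are
  irrelevant.
\<close>

record 'a hspace =
  hset :: "'a set"
  hinner :: "'a \<Rightarrow> 'a \<Rightarrow> complex"

definition hnorm :: "'a hspace \<Rightarrow> 'a \<Rightarrow> real"
  where "hnorm H x = sqrt (Re (hinner H x x))"

definition hconverges :: "'a::complex_vector hspace \<Rightarrow> (nat \<Rightarrow> 'a) \<Rightarrow> 'a \<Rightarrow> bool"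
  where "hconverges H X l \<longleftrightarrow> l \<in> hset H \<and> (\<lambda>k. hnorm H (X k - l)) \<longlonglongrightarrow> 0"

definition hCauchy :: "'a::complex_vector hspace \<Rightarrow> (nat \<Rightarrow> 'a) \<Rightarrow> bool"
  where "hCauchy H X \<longleftrightarrow> (\<forall>e>0. \<exists>N. \<forall>i\<ge>N. \<forall>j\<ge>N. hnorm H (X i - X j) < e)"

definition hilbert_space :: "'a::complex_vector hspace \<Rightarrow> bool"
  where "hilbert_space H \<longleftrightarrow>
    complex_vector.subspace (hset H) \<and>
    (\<forall>x\<in>hset H. \<forall>y\<in>hset H. \<forall>z\<in>hset H. hinner H (x + y) z = hinner H x z + hinner H y z) \<and>
    (\<forall>c. \<forall>x\<in>hset H. \<forall>y\<in>hset H. hinner H (c *\<^sub>C x) y = c * hinner H x y) \<and>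
    (\<forall>x\<in>hset H. \<forall>y\<in>hset H. hinner H y x = cnj (hinner H x y)) \<and>
    (\<forall>x\<in>hset H. x \<noteq> 0 \<longrightarrow> 0 < Re (hinner H x x)) \<and>
    (\<forall>X. (\<forall>k. X k \<in> hset H) \<and> hCauchy H X \<longrightarrow> (\<exists>l. hconverges H X l))"

definition bounded_operator ::
    "'a::complex_vector hspace \<Rightarrow> 'b::complex_vector hspace \<Rightarrow> ('a \<Rightarrow> 'b) \<Rightarrow> bool"
  where "bounded_operator H K T \<longleftrightarrow>
    (\<forall>x\<in>hset H. T x \<in> hset K) \<and>
    (\<forall>x\<in>hset H. \<forall>y\<in>hset H. T (x + y) = T x + T y) \<and>
    (\<forall>c. \<forall>x\<in>hset H. T (c *\<^sub>C x) = c *\<^sub>C T x) \<and>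
    (\<exists>C. \<forall>x\<in>hset H. hnorm K (T x) \<le> C * hnorm H x)"

definition contraction ::
    "'a::complex_vector hspace \<Rightarrow> 'b::complex_vector hspace \<Rightarrow> ('a \<Rightarrow> 'b) \<Rightarrow> bool"
  where "contraction H K T \<longleftrightarrow>
    bounded_operator H K T \<and> (\<forall>x\<in>hset H. hnorm K (T x) \<le> hnorm H x)"

text \<open>
  By the Riesz representation theorem the described vector exists uniquely whenever \<open>T\<close> is bounded.
  A shift-invariant space contractively included in \<open>bergman n Y\<close> has a bounded restricted shift by
  the closed graph theorem.
\<close>

definition adjoint_op :: "'a hspace \<Rightarrow> 'b hspace \<Rightarrow> ('a \<Rightarrow> 'b) \<Rightarrow> 'b \<Rightarrow> 'a"
  where "adjoint_op H K T y =
    (THE x. x \<in> hset H \<and> (\<forall>h\<in>hset H. hinner K (T h) y = hinner H h x))"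

definition positive_operator :: "'a::complex_vector hspace \<Rightarrow> ('a \<Rightarrow> 'a) \<Rightarrow> bool"
  where "positive_operator H T \<longleftrightarrow>
    bounded_operator H H T \<and>
    (\<forall>x\<in>hset H. hinner H (T x) x \<in> \<real> \<and> 0 \<le> Re (hinner H (T x) x))"

definition kernel_op :: "'a hspace \<Rightarrow> ('a \<Rightarrow> 'b::zero) \<Rightarrow> 'a set"
  where "kernel_op H T = {x \<in> hset H. T x = 0}"

definition orth_complement :: "'a hspace \<Rightarrow> 'a set \<Rightarrow> 'a set"
  where "orth_complement H S = {x \<in> hset H. \<forall>y\<in>S. hinner H x y = 0}"

definition orth_projection :: "'a::complex_vector hspace \<Rightarrow> 'a set \<Rightarrow> 'a \<Rightarrow> 'a"
  where "orth_projection H L x = (THE y. y \<in> L \<and> x - y \<in> orth_complement H L)"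

definition strongly_stable :: "'a::complex_vector hspace \<Rightarrow> ('a \<Rightarrow> 'a) \<Rightarrow> bool"
  where "strongly_stable H A \<longleftrightarrow>
    bounded_operator H H A \<and> (\<forall>x\<in>hset H. (\<lambda>k. hnorm H ((A ^^ k) x)) \<longlonglongrightarrow> 0)"

definition hypercontraction :: "nat \<Rightarrow> 'a::complex_vector hspace \<Rightarrow> ('a \<Rightarrow> 'a) \<Rightarrow> bool"
  where "hypercontraction n H A \<longleftrightarrow>
    bounded_operator H H A \<and>
    (\<forall>k\<le>n. positive_operator H
      (\<lambda>x. \<Sum>j\<le>k. ((-1) ^ j * of_nat (k choose j)) *\<^sub>C (adjoint_op H H A ^^ j) ((A ^^ j) x)))"

definition mu :: "nat \<Rightarrow> nat \<Rightarrow> real"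
  where "mu n j = 1 / real ((n + j - 1) choose j)"

text \<open>
  Functions on the open unit disk are represented by functions on the complex plane that vanish
  off the disk, so that equality and the pointwise operations are those of the disk.
\<close>

definition disk_series :: "'y::complex_vector hspace \<Rightarrow> (nat \<Rightarrow> 'y) \<Rightarrow> (complex \<Rightarrow> 'y) \<Rightarrow> bool"
  where "disk_series Y a f \<longleftrightarrow>
    (\<forall>j. a j \<in> hset Y) \<and>
    (\<forall>z\<in>ball 0 1. hconverges Y (\<lambda>N. \<Sum>j<N. z ^ j *\<^sub>C a j) (f z)) \<and>
    (\<forall>z. z \<notin> ball 0 1 \<longrightarrow> f z = 0)"

definition taylor_coeff :: "'y::complex_vector hspace \<Rightarrow> (complex \<Rightarrow> 'y) \<Rightarrow> nat \<Rightarrow> 'y"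
  where "taylor_coeff Y f = (THE a. disk_series Y a f)"

text \<open>The inner product is the polarization of the norm \<open>\<Sum>j. mu n j * \<parallel>f\<^sub>j\<parallel>\<^sup>2\<close>.\<close>

definition bergman :: "nat \<Rightarrow> 'y::complex_vector hspace \<Rightarrow> (complex \<Rightarrow> 'y) hspace"
  where "bergman n Y =
    \<lparr>hset = {f. \<exists>a. disk_series Y a f \<and> summable (\<lambda>j. mu n j * (hnorm Y (a j))\<^sup>2)},
     hinner = (\<lambda>f g. \<Sum>j. of_real (mu n j) * hinner Y (taylor_coeff Y f j) (taylor_coeff Y g j))\<rparr>"

definition shift :: "(complex \<Rightarrow> 'y::complex_vector) \<Rightarrow> complex \<Rightarrow> 'y"
  where "shift f = (\<lambda>z. z *\<^sub>C f z)"

definition mult_op :: "(complex \<Rightarrow> 'u \<Rightarrow> 'y::zero) \<Rightarrow> (complex \<Rightarrow> 'u) \<Rightarrow> complex \<Rightarrow> 'y"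
  where "mult_op \<Theta> f = (\<lambda>z. if z \<in> ball 0 1 then \<Theta> z (f z) else 0)"

text \<open>Analyticity of \<open>\<Theta>\<close> on the disk is a consequence: constants are mapped into \<open>bergman n Y\<close>.\<close>

definition contractive_multiplier ::
    "nat \<Rightarrow> 'u::complex_vector hspace \<Rightarrow> 'y::complex_vector hspace \<Rightarrow> (complex \<Rightarrow> 'u \<Rightarrow> 'y) \<Rightarrow> bool"
  where "contractive_multiplier n U Y \<Theta> \<longleftrightarrow>
    (\<forall>z\<in>ball 0 1. bounded_operator U Y (\<Theta> z)) \<and>
    contraction (bergman n U) (bergman n Y) (mult_op \<Theta>)"

definition contractively_included :: "'a hspace \<Rightarrow> 'a hspace \<Rightarrow> bool"
  where "contractively_included M H \<longleftrightarrow>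
    hset M \<subseteq> hset H \<and> (\<forall>f\<in>hset M. hnorm H f \<le> hnorm M f)"

definition is_lifted_range ::
    "nat \<Rightarrow> 'u::complex_vector hspace \<Rightarrow> (complex \<Rightarrow> 'u \<Rightarrow> 'y::complex_vector)
      \<Rightarrow> (complex \<Rightarrow> 'y) hspace \<Rightarrow> bool"
  where "is_lifted_range n U \<Theta> M \<longleftrightarrow>
    hset M = mult_op \<Theta> ` hset (bergman n U) \<and>
    (let Q = orth_projection (bergman n U)
               (orth_complement (bergman n U) (kernel_op (bergman n U) (mult_op \<Theta>)))
     in \<forall>f\<in>hset (bergman n U). hnorm M (mult_op \<Theta> f) = hnorm (bergman n U) (Q f))"

end

theory Submission
  imports Defs
begin

text \<open>
  Write \<open>S\<close> for the shift on a weighted Bergman space and \<open>B\<close> for its adjoint, the backward shift.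
  Both directions compare the adjoint \<open>A\<close> of the shift of \<open>M\<close> with \<open>B\<close>.

  Suppose that \<open>M\<close> is the lifted range of \<open>\<Theta>\<close>.  Multiplication by \<open>\<Theta>\<close> maps the orthogonal complement
  \<open>L\<close> of its kernel unitarily onto \<open>M\<close> and commutes with the shifts.  The kernel is invariant under
  \<open>S\<close>, so \<open>L\<close> is invariant under \<open>B\<close>, and \<open>A\<close> is unitarily equivalent to \<open>B\<close> restricted to \<open>L\<close>
  (\<open>lifted_range_imp_conditions\<close>).  Strong stability and hypercontractivity only speak of the numbers
  \<open>\<parallel>B\<^sup>j f\<parallel>\<close> and so pass to invariant subspaces.  For \<open>B\<close> itself stability is the convergence of the
  series that defines the norm (\<open>backshift_stable\<close>), and hypercontractivity says that the Taylor
  coefficients of \<open>(1 - z)\<^sup>k (1 - z)\<^sup>-\<^sup>n\<close> are nonnegative for \<open>k \<le> n\<close> (\<open>hdiff_backshift_sums\<close>).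

  Conversely let \<open>\<beta>\<^sub>k(x) = \<Sum>j\<le>k. (-1)\<^sup>j (k choose j) \<parallel>A\<^sup>j x\<parallel>\<^sup>2\<close>.  These quantities satisfy
  \<open>\<beta>\<^sub>k\<^sub>+\<^sub>1(x) = \<beta>\<^sub>k(x) - \<beta>\<^sub>k(A x)\<close>, and repeated summation by parts turns stability and the positivity of
  all \<open>\<beta>\<^sub>k\<close> with \<open>k \<le> n\<close> into the identity
  \<open>\<parallel>x\<parallel>\<^sup>2 = \<Sum>j. (n+j-1 choose j) \<beta>\<^sub>n(A\<^sup>j x)\<close> (\<open>hdiff_weighted_sums\<close>).  Let \<open>d\<close> be a square root of the
  positive operator with quadratic form \<open>\<beta>\<^sub>n\<close> (\<open>positive_operator_sqrt\<close>).  The identity says that the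
  observability map \<open>x \<mapsto> \<Sum>j. (n+j-1 choose j) z\<^sup>j d A\<^sup>j x\<close> is an isometry from \<open>M\<close> into the Bergman
  space with coefficients in \<open>M\<close>, and this map carries \<open>A\<close> to \<open>B\<close>.  Its adjoint \<open>W\<close> is therefore a
  coisometry onto \<open>M\<close> that commutes with the shifts.  Such a map is determined by its values on
  constants, hence it is multiplication by \<open>\<Theta>(z) u = (W u)(z)\<close> (\<open>conditions_imp_lifted_range\<close>).

  The operator \<open>A\<close> is given by a definite description, which describes an adjoint only if the shift of
  \<open>M\<close> is bounded.  That follows from the boundedness of \<open>A\<close>: the vectors representing the Taylor
  coefficient functionals lie in the domain of the adjoint for every invariant \<open>M\<close>, and they separate
  the points of \<open>M\<close> (\<open>adjoint_of_shift\<close>).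
\<close>

section \<open>Binomial weights and iterated differences\<close>

text \<open>The Taylor coefficients of \<open>(1 - z)\<^sup>-\<^sup>n\<close>, and the reciprocals of the Bergman weights.\<close>
definition rho :: "nat \<Rightarrow> nat \<Rightarrow> real"
  where "rho n j = real ((n + j - 1) choose j)"

lemma mu_rho: "mu n j = 1 / rho n j"
  by (simp add: mu_def rho_def)

lemma rho_0 [simp]: "rho n 0 = 1"
  by (simp add: rho_def)

lemma rho_zero_Suc [simp]: "rho 0 (Suc j) = 0"
  by (simp add: rho_def)

lemma rho_nonneg [simp]: "0 \<le> rho n j"
  by (simp add: rho_def)

text \<open>Pascal's rule; in terms of generating functions, \<open>(1 - z) (1 - z)\<^sup>-\<^sup>n\<^sup>-\<^sup>1 = (1 - z)\<^sup>-\<^sup>n\<close>.\<close>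
lemma rho_Suc_Suc: "rho (Suc n) (Suc j) = rho (Suc n) j + rho n (Suc j)"
  by (simp add: rho_def)

lemma rho_ge_1: "1 \<le> n \<Longrightarrow> 1 \<le> rho n j"
  using zero_less_binomial[of j "n + j - 1"] by (simp add: rho_def Suc_le_eq)

lemma rho_mono_right: "1 \<le> n \<Longrightarrow> i \<le> j \<Longrightarrow> rho n i \<le> rho n j"
  by (rotate_tac, induction rule: dec_induct)
    (auto intro: order_trans simp: rho_Suc_Suc dest!: Suc_le_D)

lemma rho_sum: "(\<Sum>j\<le>N. rho n j) = rho (Suc n) N"
  by (induction N) (simp_all add: rho_Suc_Suc)

lemma summable_rho_power:
  assumes "1 \<le> n" "0 \<le> t" "t < 1" shows "summable (\<lambda>j. rho n j * t ^ j)"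
proof -
  have "((- real n) gchoose j) * (- t) ^ j = rho n j * t ^ j" for j
  proof -
    have "(real n + real j - 1) = real (n + j - 1)"
      using assms(1) by (simp add: of_nat_diff)
    then have "((- real n) gchoose j) = (- 1) ^ j * rho n j"
      by (simp only: gbinomial_minus rho_def binomial_gbinomial)
    moreover have "(- t) ^ j = (-1) ^ j * t ^ j"
      by (metis mult_minus1 power_mult_distrib)
    ultimately show ?thesis
      by (simp flip: power_mult_distrib)
  qed
  moreover have "summable (\<lambda>j. ((- real n) gchoose j) * (- t) ^ j)"
    using gen_binomial_real[of "- t" "- real n"] assms by (simp add: sums_iff)
  ultimately show ?thesis by simp
qed

text \<open>
  The \<open>k\<close>-th iterated difference of \<open>s\<close> at \<open>0\<close>, signed so that \<open>hdiff 1 s = s 0 - s 1\<close>.  An operator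
  \<open>T\<close> is an \<open>n\<close>-hypercontraction when these differences of \<open>\<lambda>j. \<parallel>T\<^sup>j x\<parallel>\<^sup>2\<close> are nonnegative for every \<open>x\<close>
  and all orders up to \<open>n\<close>.
\<close>
definition hdiff :: "nat \<Rightarrow> (nat \<Rightarrow> real) \<Rightarrow> real"
  where "hdiff k s = (\<Sum>j\<le>k. (- 1) ^ j * real (k choose j) * s j)"

lemma hdiff_0 [simp]: "hdiff 0 s = s 0"
  by (simp add: hdiff_def)

lemma hdiff_Suc: "hdiff (Suc k) s = hdiff k s - hdiff k (\<lambda>j. s (Suc j))"
proof -
  have "hdiff (Suc k) s = s 0 + (\<Sum>j\<le>k. (- 1) ^ Suc j * real (Suc k choose Suc j) * s (Suc j))"
    unfolding hdiff_def by (subst sum.atMost_Suc_shift) simp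
  also have "\<dots> = s 0 + (\<Sum>j\<le>k. (- 1) ^ Suc j * real (k choose Suc j) * s (Suc j))
      - hdiff k (\<lambda>j. s (Suc j))"
    unfolding hdiff_def by (simp add: sum.distrib[symmetric] sum_negf[symmetric] algebra_simps)
  also have "s 0 + (\<Sum>j\<le>k. (- 1) ^ Suc j * real (k choose Suc j) * s (Suc j)) =
      (\<Sum>j\<le>Suc k. (- 1) ^ j * real (k choose j) * s j)"
    by (subst sum.atMost_Suc_shift) simp
  also have "\<dots> = hdiff k s"
    unfolding hdiff_def by simp
  finally show ?thesis .
qed

text \<open>
  The boundary term of a summation by parts vanishes.  Split the sum of the \<open>r j\<close> at a fixed \<open>M\<close>: the
  first part is constant and is multiplied by a null sequence; in the second part \<open>b (Suc N) \<le> b j\<close>, so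
  it is at most a tail of the convergent series.
\<close>
lemma weighted_boundary_tendsto_0:
  fixes r b :: "nat \<Rightarrow> real"
  assumes r: "\<And>j. 0 \<le> r j" and b: "\<And>j. 0 \<le> b j" and dec: "\<And>j. b (Suc j) \<le> b j"
    and b0: "b \<longlonglongrightarrow> 0" and s: "summable (\<lambda>j. r j * b j)"
  shows "(\<lambda>N. (\<Sum>j\<le>N. r j) * b (Suc N)) \<longlonglongrightarrow> 0"
proof (rule LIMSEQ_I)
  fix e :: real assume e: "0 < e"
  have mono: "b j \<le> b i" if "i \<le> j" for i j
    using that by (induction rule: dec_induct) (auto intro: order_trans dec)
  obtain M where M: "\<And>p q. M \<le> p \<Longrightarrow> norm (sum (\<lambda>j. r j * b j) {p..<q}) < e / 2"
    using s e unfolding summable_Cauchy by (meson half_gt_zero)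
  have "(\<lambda>N. (\<Sum>j<M. r j) * b (Suc N)) \<longlonglongrightarrow> (\<Sum>j<M. r j) * 0"
    by (intro tendsto_mult tendsto_const LIMSEQ_Suc b0)
  then have "\<forall>\<^sub>F N in sequentially. (\<Sum>j<M. r j) * b (Suc N) < e / 2"
    using e by (intro order_tendstoD(2)) auto
  then obtain N0 where N0: "\<And>N. N \<ge> N0 \<Longrightarrow> (\<Sum>j<M. r j) * b (Suc N) < e / 2"
    by (auto simp: eventually_sequentially)
  have "norm ((\<Sum>j\<le>N. r j) * b (Suc N) - 0) < e" if N: "N \<ge> max M N0" for N
  proof -
    have "(\<Sum>j\<le>N. r j) = (\<Sum>j<M. r j) + (\<Sum>j\<in>{M..<Suc N}. r j)"
      using N sum.atLeastLessThan_concat[of 0 M "Suc N" r]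
      by (simp add: atLeast0LessThan lessThan_Suc_atMost)
    then have "(\<Sum>j\<le>N. r j) * b (Suc N) = (\<Sum>j<M. r j) * b (Suc N) + (\<Sum>j\<in>{M..<Suc N}. r j * b (Suc N))"
      by (simp only: distrib_right sum_distrib_right)
    also have "(\<Sum>j\<in>{M..<Suc N}. r j * b (Suc N)) \<le> (\<Sum>j\<in>{M..<Suc N}. r j * b j)"
      by (intro sum_mono mult_left_mono mono r) auto
    also have "\<dots> < e / 2"
      using M[of M "Suc N"] by (simp only: real_norm_def abs_less_iff)
    finally have "(\<Sum>j\<le>N. r j) * b (Suc N) < e"
      using N0[of N] N by simp
    moreover have "0 \<le> (\<Sum>j\<le>N. r j) * b (Suc N)"
      by (intro mult_nonneg_nonneg sum_nonneg r b)
    ultimately show ?thesis by simp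
  qed
  then show "\<exists>N0. \<forall>N\<ge>N0. norm ((\<Sum>j\<le>N. r j) * b (Suc N) - 0) < e" by blast
qed

lemma hdiff_shift_tendsto_0:
  "s \<longlonglongrightarrow> 0 \<Longrightarrow> (\<lambda>j. hdiff k (\<lambda>i. s (i + j))) \<longlonglongrightarrow> 0"
proof (induction k)
  case (Suc k)
  have "(\<lambda>j. hdiff k (\<lambda>i. s (i + j)) - hdiff k (\<lambda>i. s (i + Suc j))) \<longlonglongrightarrow> 0 - 0"
    by (intro tendsto_diff Suc.IH Suc.prems LIMSEQ_Suc[OF Suc.IH[OF Suc.prems]])
  then show ?case by (simp add: hdiff_Suc)
qed simp

lemma rho_summation_by_parts:
  assumes "\<And>j. c j = b j - b (Suc j)"
  shows "(\<Sum>j\<le>N. rho (Suc k) j * c j) = (\<Sum>j\<le>N. rho k j * b j) - rho (Suc k) N * b (Suc N)"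
  by (induction N) (simp_all add: assms rho_Suc_Suc algebra_simps)

text \<open>
  Induction on \<open>k\<close>: \<open>rho 0\<close> is concentrated at \<open>0\<close>, so the case \<open>k = 0\<close> is trivial, and passing from
  \<open>k\<close> to \<open>Suc k\<close> is a summation by parts.  The positivity of the differences of order \<open>k\<close> and \<open>Suc k\<close>
  makes the former nonnegative and decreasing along \<open>j\<close>, which is what kills the boundary term.
\<close>
lemma hdiff_weighted_sums:
  assumes s: "s \<longlonglongrightarrow> 0" and pos: "\<And>k j. k \<le> n \<Longrightarrow> 0 \<le> hdiff k (\<lambda>i. s (i + j))" and "k \<le> n"
  shows "(\<lambda>j. rho k j * hdiff k (\<lambda>i. s (i + j))) sums s 0"
  using assms(3)
proof (induction k)
  case 0
  have "(\<lambda>j. rho 0 j * hdiff 0 (\<lambda>i. s (i + j))) = (\<lambda>j. if j = 0 then s j else 0)"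
    by (intro ext) (auto simp: gr0_conv_Suc)
  then show ?case using sums_single[of 0 s] by simp
next
  case (Suc k)
  let ?b = "\<lambda>k j. hdiff k (\<lambda>i. s (i + j))"
  have diff: "?b (Suc k) j = ?b k j - ?b k (Suc j)" for j by (simp add: hdiff_Suc)
  have IH: "(\<lambda>j. rho k j * ?b k j) sums s 0" using Suc by simp
  have part: "(\<Sum>j\<le>N. rho (Suc k) j * ?b (Suc k) j) = (\<Sum>j\<le>N. rho k j * ?b k j) - rho (Suc k) N * ?b k (Suc N)" for N
    by (rule rho_summation_by_parts) (rule diff)
  have "(\<lambda>N. (\<Sum>j\<le>N. rho k j) * ?b k (Suc N)) \<longlonglongrightarrow> 0"
    using Suc.prems pos[of k] pos[of "Suc k"] diff IH
    by (intro weighted_boundary_tendsto_0 hdiff_shift_tendsto_0 s) (auto simp: sums_iff)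
  then have "(\<lambda>N. (\<Sum>j\<le>N. rho k j * ?b k j) - rho (Suc k) N * ?b k (Suc N)) \<longlonglongrightarrow> s 0 - 0"
    using IH by (intro tendsto_diff) (simp_all add: sums_def_le rho_sum)
  then show ?case
    unfolding sums_def_le part by simp
qed

section \<open>Hilbert spaces\<close>

text \<open>
  Membership in the subspace is a side condition of every rule; the closure rules are simplification
  rules, so that the simplifier discharges these conditions.
\<close>
locale hilbert =
  fixes H :: "'a::complex_vector hspace"
  assumes hilbert: "hilbert_space H"
begin

abbreviation ip :: "'a \<Rightarrow> 'a \<Rightarrow> complex" where "ip \<equiv> hinner H"
abbreviation nrm :: "'a \<Rightarrow> real" where "nrm \<equiv> hnorm H"
abbreviation V :: "'a set" where "V \<equiv> hset H"

lemma subspace_V: "complex_vector.subspace V"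
  using hilbert by (simp add: hilbert_space_def)

lemma zero_mem [simp]: "0 \<in> V"
  and add_mem [simp]: "x \<in> V \<Longrightarrow> y \<in> V \<Longrightarrow> x + y \<in> V"
  and diff_mem [simp]: "x \<in> V \<Longrightarrow> y \<in> V \<Longrightarrow> x - y \<in> V"
  and minus_mem [simp]: "x \<in> V \<Longrightarrow> - x \<in> V"
  and scale_mem [simp]: "x \<in> V \<Longrightarrow> c *\<^sub>C x \<in> V"
  and sum_mem [simp]: "(\<And>i. i \<in> I \<Longrightarrow> f i \<in> V) \<Longrightarrow> sum f I \<in> V"
  using subspace_V
  by (auto intro: complex_vector.subspace_0 complex_vector.subspace_add complex_vector.subspace_diff
      complex_vector.subspace_neg complex_vector.subspace_scale complex_vector.subspace_sum)

lemma ip_add_left [simp]: "x \<in> V \<Longrightarrow> y \<in> V \<Longrightarrow> z \<in> V \<Longrightarrow> ip (x + y) z = ip x z + ip y z"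
  and ip_scale_left [simp]: "x \<in> V \<Longrightarrow> y \<in> V \<Longrightarrow> ip (c *\<^sub>C x) y = c * ip x y"
  and ip_commute: "x \<in> V \<Longrightarrow> y \<in> V \<Longrightarrow> ip y x = cnj (ip x y)"
  using hilbert unfolding hilbert_space_def by blast+

lemma ip_add_right [simp]: "x \<in> V \<Longrightarrow> y \<in> V \<Longrightarrow> z \<in> V \<Longrightarrow> ip z (x + y) = ip z x + ip z y"
  by (metis add_mem complex_cnj_add ip_add_left ip_commute)

lemma ip_scale_right [simp]: "x \<in> V \<Longrightarrow> y \<in> V \<Longrightarrow> ip x (c *\<^sub>C y) = cnj c * ip x y"
  by (metis complex_cnj_mult ip_commute ip_scale_left scale_mem)

lemma ip_minus_left [simp]: "x \<in> V \<Longrightarrow> y \<in> V \<Longrightarrow> ip (- x) y = - ip x y"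
  using ip_scale_left[of x y "- 1"] by (simp del: ip_scale_left)

lemma ip_minus_right [simp]: "x \<in> V \<Longrightarrow> y \<in> V \<Longrightarrow> ip x (- y) = - ip x y"
  using ip_scale_right[of x y "- 1"] by (simp del: ip_scale_right)

lemma ip_diff_left [simp]: "x \<in> V \<Longrightarrow> y \<in> V \<Longrightarrow> z \<in> V \<Longrightarrow> ip (x - y) z = ip x z - ip y z"
  using ip_add_left[of x "- y" z] by (simp del: ip_add_left)

lemma ip_diff_right [simp]: "x \<in> V \<Longrightarrow> y \<in> V \<Longrightarrow> z \<in> V \<Longrightarrow> ip z (x - y) = ip z x - ip z y"
  using ip_add_right[of x "- y" z] by (simp del: ip_add_right)

lemma ip_zero_left [simp]: "y \<in> V \<Longrightarrow> ip 0 y = 0"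
  using ip_scale_left[of 0 y 0] by (simp del: ip_scale_left)

lemma ip_zero_right [simp]: "y \<in> V \<Longrightarrow> ip y 0 = 0"
  using ip_scale_right[of y 0 0] by (simp del: ip_scale_right)

lemma ip_sum_left:
  "(\<And>i. i \<in> I \<Longrightarrow> f i \<in> V) \<Longrightarrow> y \<in> V \<Longrightarrow> ip (sum f I) y = (\<Sum>i\<in>I. ip (f i) y)"
  by (induction I rule: infinite_finite_induct) auto

lemma ip_sum_right:
  "(\<And>i. i \<in> I \<Longrightarrow> f i \<in> V) \<Longrightarrow> y \<in> V \<Longrightarrow> ip y (sum f I) = (\<Sum>i\<in>I. ip y (f i))"
  by (induction I rule: infinite_finite_induct) auto

lemma Re_ip_pos: "x \<in> V \<Longrightarrow> x \<noteq> 0 \<Longrightarrow> 0 < Re (ip x x)"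
  using hilbert unfolding hilbert_space_def by blast

lemma Re_ip_nonneg [simp]: "x \<in> V \<Longrightarrow> 0 \<le> Re (ip x x)"
  by (cases "x = 0") (auto simp: less_imp_le Re_ip_pos)

lemma nrm_nonneg [simp]: "x \<in> V \<Longrightarrow> 0 \<le> nrm x"
  by (simp add: hnorm_def)

lemma nrm_sq: "x \<in> V \<Longrightarrow> (nrm x)\<^sup>2 = Re (ip x x)"
  by (simp add: hnorm_def)

lemma ip_self: "x \<in> V \<Longrightarrow> ip x x = of_real ((nrm x)\<^sup>2)"
  using ip_commute[of x x] by (simp add: nrm_sq complex_eq_iff)

lemma nrm_zero [simp]: "nrm 0 = 0"
  by (simp add: hnorm_def)

lemma nrm_eq_0 [simp]: "x \<in> V \<Longrightarrow> nrm x = 0 \<longleftrightarrow> x = 0"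
  using Re_ip_pos[of x] by (cases "x = 0") (auto simp: hnorm_def)

lemma nrm_scale: "x \<in> V \<Longrightarrow> nrm (c *\<^sub>C x) = cmod c * nrm x"
proof -
  assume x: "x \<in> V"
  have "ip (c *\<^sub>C x) (c *\<^sub>C x) = c * cnj c * of_real ((nrm x)\<^sup>2)"
    using x by (simp add: ip_self[of x])
  then have "Re (ip (c *\<^sub>C x) (c *\<^sub>C x)) = (cmod c)\<^sup>2 * (nrm x)\<^sup>2"
    by (simp only: complex_norm_square[symmetric] flip: of_real_mult) simp
  then show ?thesis
    using x by (simp add: hnorm_def real_sqrt_mult)
qed

lemma nrm_minus [simp]: "x \<in> V \<Longrightarrow> nrm (- x) = nrm x"
  using nrm_scale[of x "- 1"] by simp

lemma nrm_minus_commute: "x \<in> V \<Longrightarrow> y \<in> V \<Longrightarrow> nrm (x - y) = nrm (y - x)"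
  using nrm_minus[of "x - y"] by simp

lemma nrm_sq_add:
  "x \<in> V \<Longrightarrow> y \<in> V \<Longrightarrow> (nrm (x + y))\<^sup>2 = (nrm x)\<^sup>2 + 2 * Re (ip x y) + (nrm y)\<^sup>2"
  using ip_commute[of x y] by (simp add: nrm_sq)

lemma nrm_sq_diff:
  "x \<in> V \<Longrightarrow> y \<in> V \<Longrightarrow> (nrm (x - y))\<^sup>2 = (nrm x)\<^sup>2 - 2 * Re (ip x y) + (nrm y)\<^sup>2"
  using ip_commute[of x y] by (simp add: nrm_sq)

text \<open>The distance from \<open>x\<close> to its projection on the line through \<open>y\<close> is nonnegative.\<close>
lemma cauchy_schwarz: 
  assumes x: "x \<in> V" and y: "y \<in> V" shows "cmod (ip x y) \<le> nrm x * nrm y"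
proof (cases "y = 0")
  case True
  then show ?thesis using x by simp
next
  case False
  let ?r = "(nrm y)\<^sup>2"
  have r: "?r > 0" using False y by simp
  define c where "c = ip x y / of_real ?r"
  have "Re (c * cnj (ip x y)) = (cmod (ip x y))\<^sup>2 / ?r"
    by (simp add: c_def complex_mult_cnj cmod_power2)
  moreover have "(cmod c)\<^sup>2 * ?r = (cmod (ip x y))\<^sup>2 / ?r"
    using r unfolding c_def norm_divide power_divide norm_of_real by (simp add: power2_eq_square)
  moreover have "Re (cnj c * ip x y) = Re (c * cnj (ip x y))"
    by simp
  ultimately have "(nrm (x - c *\<^sub>C y))\<^sup>2 = (nrm x)\<^sup>2 - (cmod (ip x y))\<^sup>2 / ?r"
    using x y by (simp add: nrm_sq_diff nrm_scale power_mult_distrib)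
  then have "(cmod (ip x y))\<^sup>2 / ?r \<le> (nrm x)\<^sup>2"
    by (metis diff_ge_0_iff_ge zero_le_power2)
  then have "(cmod (ip x y))\<^sup>2 \<le> (nrm x * nrm y)\<^sup>2"
    using r by (simp add: field_simps)
  then show ?thesis
    by (rule power2_le_imp_le) (use x y in simp_all)
qed

lemma nrm_triangle: 
  assumes x: "x \<in> V" and y: "y \<in> V" shows "nrm (x + y) \<le> nrm x + nrm y"
proof -
  have "Re (ip x y) \<le> nrm x * nrm y"
    using cauchy_schwarz[OF x y] complex_Re_le_cmod order_trans by blast
  then have "(nrm (x + y))\<^sup>2 \<le> (nrm x + nrm y)\<^sup>2"
    using x y by (simp add: nrm_sq_add power2_sum)
  then show ?thesis
    by (rule power2_le_imp_le) (use x y in simp_all)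
qed

lemma nrm_triangle_diff: 
  assumes "x \<in> V" "y \<in> V" "z \<in> V" shows "nrm (x - z) \<le> nrm (x - y) + nrm (y - z)"
  using nrm_triangle[of "x - y" "y - z"] assms by simp

lemma nrm_sum: "(\<And>i. i \<in> I \<Longrightarrow> f i \<in> V) \<Longrightarrow> nrm (sum f I) \<le> (\<Sum>i\<in>I. nrm (f i))"
  by (induction I rule: infinite_finite_induct) (auto intro: order_trans[OF nrm_triangle])

text \<open>
  Multiplied by \<open>4\<close>.  Two forms with the same norm agree by this identity, which is how a condition on
  norms, as in a lifted range, yields a statement on inner products.
\<close>
lemma polarization:
  assumes "x \<in> V" "y \<in> V"
  shows "4 * ip x y = of_real ((nrm (x + y))\<^sup>2 - (nrm (x - y))\<^sup>2)
     + \<i> * of_real ((nrm (x + \<i> *\<^sub>C y))\<^sup>2 - (nrm (x - \<i> *\<^sub>C y))\<^sup>2)"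
  using assms by (simp add: nrm_sq_add nrm_sq_diff complex_eq_iff)

lemma eq_if_ip_eq:
  assumes "x \<in> V" "y \<in> V" "\<And>z. z \<in> V \<Longrightarrow> ip z x = ip z y" shows "x = y"
proof -
  have "Re (ip (x - y) (x - y)) = 0"
    using assms by (simp del: ip_diff_left)
  then show ?thesis
    using assms Re_ip_pos[of "x - y"] by fastforce
qed

lemma eq_if_ip_eq_left:
  assumes "x \<in> V" "y \<in> V" "\<And>z. z \<in> V \<Longrightarrow> ip x z = ip y z" shows "x = y"
  using assms eq_if_ip_eq by (metis ip_commute)

lemma hconverges_unique:
  assumes X: "\<And>k. X k \<in> V" and "hconverges H X l" "hconverges H X m" shows "l = m"
proof -
  from assms have lm: "l \<in> V" "m \<in> V" by (auto simp: hconverges_def)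
  have "(\<lambda>k. nrm (X k - l) + nrm (X k - m)) \<longlonglongrightarrow> 0 + 0"
    using assms by (intro tendsto_add) (auto simp: hconverges_def)
  moreover have "nrm (l - m) \<le> nrm (X k - l) + nrm (X k - m)" for k
    using nrm_triangle_diff[of l "X k" m] X lm nrm_minus_commute[of l "X k"] by simp
  ultimately have "nrm (l - m) \<le> 0"
    by (intro LIMSEQ_le_const[of _ 0]) auto
  then show ?thesis
    using lm nrm_nonneg[of "l - m"] nrm_eq_0[of "l - m"]
    by (metis diff_mem eq_iff_diff_eq_0 order_antisym)
qed

lemma hconvergesI:
  assumes "l \<in> V" "\<And>k. X k \<in> V" "g \<longlonglongrightarrow> 0" "\<And>k. nrm (X k - l) \<le> g k"
  shows "hconverges H X l"
proof -
  have "(\<lambda>k. nrm (X k - l)) \<longlonglongrightarrow> 0"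
  proof (rule tendsto_sandwich[OF _ _ tendsto_const assms(3)])
    show "\<forall>\<^sub>F k in sequentially. 0 \<le> nrm (X k - l)"
      using assms(1,2) by (intro always_eventually allI nrm_nonneg diff_mem)
    show "\<forall>\<^sub>F k in sequentially. nrm (X k - l) \<le> g k"
      using assms(4) by (intro always_eventually allI)
  qed
  then show ?thesis using assms(1) by (simp add: hconverges_def)
qed

lemma hconverges_const: "l \<in> V \<Longrightarrow> hconverges H (\<lambda>_. l) l"
  by (simp add: hconverges_def)

lemma hconverges_add:
  assumes "\<And>k. X k \<in> V" "\<And>k. Y k \<in> V" "hconverges H X l" "hconverges H Y m"
  shows "hconverges H (\<lambda>k. X k + Y k) (l + m)"
proof -
  from assms have lm: "l \<in> V" "m \<in> V" by (auto simp: hconverges_def)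
  have "(\<lambda>k. nrm (X k - l) + nrm (Y k - m)) \<longlonglongrightarrow> 0 + 0"
    using assms by (intro tendsto_add) (auto simp: hconverges_def)
  moreover have "nrm (X k + Y k - (l + m)) \<le> nrm (X k - l) + nrm (Y k - m)" for k
    using nrm_triangle[of "X k - l" "Y k - m"] assms lm by (simp add: algebra_simps)
  ultimately show ?thesis
    using assms(1,2) lm by (intro hconvergesI[of _ _ "\<lambda>k. nrm (X k - l) + nrm (Y k - m)"]) simp_all
qed

lemma hconverges_scale:
  assumes "\<And>k. X k \<in> V" "hconverges H X l"
  shows "hconverges H (\<lambda>k. c *\<^sub>C X k) (c *\<^sub>C l)"
proof -
  have l: "l \<in> V" using assms by (auto simp: hconverges_def)
  have "(\<lambda>k. cmod c * nrm (X k - l)) \<longlonglongrightarrow> cmod c * 0"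
    using assms by (intro tendsto_mult tendsto_const) (auto simp: hconverges_def)
  moreover have "nrm (c *\<^sub>C X k - c *\<^sub>C l) = cmod c * nrm (X k - l)" for k
    using assms l by (simp add: nrm_scale flip: complex_vector.scale_right_diff_distrib)
  ultimately show ?thesis
    using l by (simp add: hconverges_def)
qed

lemma hconverges_diff:
  assumes "\<And>k. X k \<in> V" "\<And>k. Y k \<in> V" "hconverges H X l" "hconverges H Y m"
  shows "hconverges H (\<lambda>k. X k - Y k) (l - m)"
  using hconverges_add[of X "\<lambda>k. (-1) *\<^sub>C Y k" l "(-1) *\<^sub>C m"] hconverges_scale[of Y m "-1"] assms
  by simp

lemma hconverges_operator:
  assumes K: "hilbert_space K" and T: "bounded_operator H K T"
    and X: "\<And>k. X k \<in> V" "hconverges H X l"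
  shows "hconverges K (\<lambda>k. T (X k)) (T l)"
proof -
  interpret K: hilbert K by standard (fact K)
  have l: "l \<in> V" using X by (auto simp: hconverges_def)
  obtain C where C: "\<And>x. x \<in> V \<Longrightarrow> hnorm K (T x) \<le> C * nrm x"
    using T unfolding bounded_operator_def by blast
  have TV: "T x \<in> hset K" if "x \<in> V" for x using T that by (auto simp: bounded_operator_def)
  have "T (X k) = T (X k - l) + T l" for k
    using T X l diff_mem[of "X k" l] unfolding bounded_operator_def
    by (metis diff_add_cancel)
  then have "T (X k) - T l = T (X k - l)" for k
    by simp
  then have "hnorm K (T (X k) - T l) \<le> C * nrm (X k - l)" for k
    using C X l by simp
  moreover have "(\<lambda>k. C * nrm (X k - l)) \<longlonglongrightarrow> C * 0"
    using X by (intro tendsto_mult tendsto_const) (auto simp: hconverges_def)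
  ultimately show ?thesis
    using X(1) l TV by (intro K.hconvergesI[of _ _ "\<lambda>k. C * nrm (X k - l)"]) simp_all
qed

lemma tendsto_ip:
  assumes X: "\<And>k. X k \<in> V" "hconverges H X l" and y: "y \<in> V"
  shows "(\<lambda>k. ip (X k) y) \<longlonglongrightarrow> ip l y"
proof -
  have l: "l \<in> V" using X by (auto simp: hconverges_def)
  have "cmod (ip (X k) y - ip l y) \<le> nrm (X k - l) * nrm y" for k
    using cauchy_schwarz[of "X k - l" y] X l y by simp
  moreover have "(\<lambda>k. nrm (X k - l) * nrm y) \<longlonglongrightarrow> 0 * nrm y"
    using X by (intro tendsto_mult tendsto_const) (auto simp: hconverges_def)
  ultimately have "(\<lambda>k. ip (X k) y - ip l y) \<longlonglongrightarrow> 0"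
    by (intro Lim_null_comparison[of "\<lambda>k. ip (X k) y - ip l y" "\<lambda>k. nrm (X k - l) * nrm y"]
        always_eventually allI) simp_all
  then show ?thesis
    by (simp add: LIM_zero_iff)
qed

lemma tendsto_nrm:
  assumes X: "\<And>k. X k \<in> V" "hconverges H X l"
  shows "(\<lambda>k. nrm (X k)) \<longlonglongrightarrow> nrm l"
proof -
  have l: "l \<in> V" using X by (auto simp: hconverges_def)
  have "\<bar>nrm (X k) - nrm l\<bar> \<le> nrm (X k - l)" for k
    using nrm_triangle_diff[of "X k" l 0] nrm_triangle_diff[of l "X k" 0]
      nrm_minus_commute[of l "X k"] X l by simp
  moreover have "(\<lambda>k. nrm (X k - l)) \<longlonglongrightarrow> 0"
    using X(2) unfolding hconverges_def by blast
  ultimately have "(\<lambda>k. nrm (X k) - nrm l) \<longlonglongrightarrow> 0"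
    by (intro Lim_null_comparison[of "\<lambda>k. nrm (X k) - nrm l" "\<lambda>k. nrm (X k - l)"]
        always_eventually allI) (simp_all only: real_norm_def)
  then show ?thesis
    by (simp add: LIM_zero_iff)
qed

lemma complete: "(\<And>k. X k \<in> V) \<Longrightarrow> hCauchy H X \<Longrightarrow> \<exists>l. hconverges H X l"
  using hilbert unfolding hilbert_space_def by blast

text \<open>Absolutely convergent series converge, by completeness.\<close>
lemma abs_summable_hconverges:
  assumes a: "\<And>j. a j \<in> V" and s: "summable b" and ab: "\<And>j. nrm (a j) \<le> b j"
  obtains l where "hconverges H (\<lambda>N. \<Sum>j<N. a j) l" "nrm l \<le> suminf b"
proof -
  have b0: "0 \<le> b j" for j using ab[of j] nrm_nonneg[OF a[of j]] by linarith
  have part: "nrm ((\<Sum>j<p. a j) - (\<Sum>j<m. a j)) \<le> \<bar>(\<Sum>j<p. b j) - (\<Sum>j<m. b j)\<bar>" for p m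
  proof -
    have *: "nrm ((\<Sum>j<p. a j) - (\<Sum>j<m. a j)) \<le> (\<Sum>j<p. b j) - (\<Sum>j<m. b j)" if "m \<le> p" for p m
    proof -
      have "(\<Sum>j<p. a j) - (\<Sum>j<m. a j) = (\<Sum>j\<in>{m..<p}. a j)"
        using sum_diff_nat_ivl[of 0 m p a] that by (simp add: atLeast0LessThan)
      moreover have "(\<Sum>j<p. b j) - (\<Sum>j<m. b j) = (\<Sum>j\<in>{m..<p}. b j)"
        using sum_diff_nat_ivl[of 0 m p b] that by (simp add: atLeast0LessThan)
      ultimately show ?thesis
        using nrm_sum[of "{m..<p}" a] a sum_mono[of "{m..<p}" "\<lambda>j. nrm (a j)" b] ab
        by simp
    qed
    show ?thesis
      using *[of m p] *[of p m] nrm_minus_commute[of "\<Sum>j<p. a j" "\<Sum>j<m. a j"] a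
      by (cases "m \<le> p") (auto simp: abs_if)
  qed
  have "Cauchy (\<lambda>N. \<Sum>j<N. b j)"
    using s by (simp add: summable_iff_convergent Cauchy_convergent_iff)
  then have "hCauchy H (\<lambda>N. \<Sum>j<N. a j)"
    unfolding hCauchy_def Cauchy_iff using part
    by (metis (no_types, lifting) order_le_less_trans real_norm_def)
  then obtain l where l: "hconverges H (\<lambda>N. \<Sum>j<N. a j) l"
    using complete[of "\<lambda>N. \<Sum>j<N. a j"] a by auto
  have "(\<lambda>N. nrm (\<Sum>j<N. a j)) \<longlonglongrightarrow> nrm l"
    using tendsto_nrm[OF _ l] a by simp
  moreover have "nrm (\<Sum>j<N. a j) \<le> suminf b" for N
    using part[of N 0] sum_le_suminf[OF s, of "{..<N}"] b0 sum_nonneg[of "{..<N}" b] by auto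
  ultimately have "nrm l \<le> suminf b"
    by (intro LIMSEQ_le_const2[of _ "nrm l"]) auto
  with l show ?thesis by (rule that)
qed

text \<open>
  The representing vector minimizes \<open>J x = \<parallel>x\<parallel>\<^sup>2 - 2 Re (\<phi> x)\<close>, which equals \<open>\<parallel>x - v\<parallel>\<^sup>2 - \<parallel>v\<parallel>\<^sup>2\<close> if
  \<open>\<phi>\<close> is represented by \<open>v\<close>.  Since \<open>Re \<circ> \<phi>\<close> is additive, the parallelogram law makes every minimizing
  sequence Cauchy, and the first variation of \<open>J\<close> at its limit vanishes.
\<close>
lemma riesz:
  assumes add: "\<And>x y. x \<in> V \<Longrightarrow> y \<in> V \<Longrightarrow> \<phi> (x + y) = \<phi> x + \<phi> y"
    and scale: "\<And>c x. x \<in> V \<Longrightarrow> \<phi> (c *\<^sub>C x) = c * \<phi> x"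
    and bound: "\<And>x. x \<in> V \<Longrightarrow> cmod (\<phi> x) \<le> C * nrm x"
  obtains v where "v \<in> V" "\<And>x. x \<in> V \<Longrightarrow> \<phi> x = ip x v"
proof -
  define J where "J x = (nrm x)\<^sup>2 - 2 * Re (\<phi> x)" for x
  have Jge: "J x \<ge> - C\<^sup>2" if "x \<in> V" for x
  proof -
    have "Re (\<phi> x) \<le> C * nrm x"
      using bound[OF that] complex_Re_le_cmod order_trans by blast
    moreover have "0 \<le> (nrm x - C)\<^sup>2" by simp
    ultimately show ?thesis
      unfolding J_def power2_diff by (simp add: algebra_simps)
  qed
  define m where "m = Inf (J ` V)"
  have bdd: "bdd_below (J ` V)" using Jge by (auto intro!: bdd_belowI[of _ "- C\<^sup>2"])
  have mle: "m \<le> J x" if "x \<in> V" for x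
    unfolding m_def using bdd that by (auto intro: cInf_lower)
  have "\<exists>x\<in>V. J x < m + 1 / real (Suc k)" for k
  proof -
    have "V \<noteq> {}" using zero_mem by blast
    then show ?thesis
      using cInf_less_iff[of "J ` V" "m + 1 / real (Suc k)"] bdd unfolding m_def by auto
  qed
  then obtain X where X: "\<And>k. X k \<in> V" "\<And>k. J (X k) < m + 1 / real (Suc k)"
    by metis
  have est: "(nrm (X i - X j))\<^sup>2 \<le> 2 / real (Suc i) + 2 / real (Suc j)" for i j
  proof -
    let ?h = "(1/2) *\<^sub>C (X i + X j)"
    have "(nrm ?h)\<^sup>2 = (nrm (X i + X j))\<^sup>2 / 4"
      using X by (simp add: nrm_scale power_mult_distrib power2_eq_square)
    moreover have "\<phi> ?h = (\<phi> (X i) + \<phi> (X j)) / 2"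
      using X(1) scale[of "X i + X j" "1/2"] add by simp
    from arg_cong[OF this, of Re] have "Re (\<phi> ?h) = (Re (\<phi> (X i)) + Re (\<phi> (X j))) / 2"
      by (simp only: Re_divide_numeral plus_complex.sel)
    ultimately have "(nrm (X i - X j))\<^sup>2 = 2 * J (X i) + 2 * J (X j) - 4 * J ?h"
      using X(1)[of i] X(1)[of j] by (simp add: J_def nrm_sq_add nrm_sq_diff)
    also have "\<dots> \<le> 2 * (m + 1 / real (Suc i)) + 2 * (m + 1 / real (Suc j)) - 4 * m"
      using X(2)[of i] X(2)[of j] mle[of ?h] X(1) by (simp del: of_nat_Suc)
    finally show ?thesis by simp
  qed
  have "hCauchy H X"
    unfolding hCauchy_def
  proof (intro allI impI)
    fix e :: real assume e: "e > 0"
    then obtain N where N: "1 / real (Suc N) < e\<^sup>2 / 4"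
      using nat_approx_posE[of "e\<^sup>2 / 4"] by auto
    have "nrm (X i - X j) < e" if "i \<ge> N" "j \<ge> N" for i j
    proof -
      have "1 / real (Suc i) \<le> 1 / real (Suc N)" "1 / real (Suc j) \<le> 1 / real (Suc N)"
        using that by (auto simp: field_simps)
      then have "(nrm (X i - X j))\<^sup>2 < e\<^sup>2"
        using est[of i j] N by simp
      then show ?thesis by (rule power2_less_imp_less) (use e in simp)
    qed
    then show "\<exists>N. \<forall>i\<ge>N. \<forall>j\<ge>N. nrm (X i - X j) < e" by blast
  qed
  then obtain v where v: "hconverges H X v"
    using complete X by blast
  then have vV: "v \<in> V" by (simp add: hconverges_def)
  \<comment> \<open>First variation in the direction \<open>h\<close>, read off along the minimizing sequence, so that
    the continuity of the inner product suffices for the passage to the limit.\<close>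
  have var: "0 \<le> 2 * t * (Re (ip v h) - Re (\<phi> h)) + t\<^sup>2 * (nrm h)\<^sup>2" if h: "h \<in> V" for h and t :: real
  proof -
    have "0 \<le> 2 * t * (Re (ip (X k) h) - Re (\<phi> h)) + t\<^sup>2 * (nrm h)\<^sup>2 + 1 / real (Suc k)" for k
    proof -
      have "J (X k + of_real t *\<^sub>C h) = J (X k) + 2 * t * (Re (ip (X k) h) - Re (\<phi> h)) + t\<^sup>2 * (nrm h)\<^sup>2"
        using X h add[of "X k" "of_real t *\<^sub>C h"] scale[of h "of_real t"]
        by (simp add: J_def nrm_sq_add nrm_scale power_mult_distrib algebra_simps)
      moreover have "m \<le> J (X k + of_real t *\<^sub>C h)" using X h mle by simp
      ultimately show ?thesis using X(2)[of k] by linarith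
    qed
    moreover have "(\<lambda>k. 2 * t * (Re (ip (X k) h) - Re (\<phi> h)) + t\<^sup>2 * (nrm h)\<^sup>2 + 1 / real (Suc k))
       \<longlonglongrightarrow> 2 * t * (Re (ip v h) - Re (\<phi> h)) + t\<^sup>2 * (nrm h)\<^sup>2 + 0"
      by (intro tendsto_intros tendsto_ip X v h LIMSEQ_Suc[OF lim_inverse_n'])
    ultimately show ?thesis
      using LIMSEQ_le_const[where a=0] by fastforce
  qed
  have Re: "Re (\<phi> h) = Re (ip v h)" if h: "h \<in> V" for h
  proof -
    define a where "a = Re (ip v h) - Re (\<phi> h)"
    define q where "q = (nrm h)\<^sup>2 + 1"
    have q: "q > 0" by (simp add: q_def add_nonneg_pos)
    \<comment> \<open>\<open>t = - a / q\<close> minimizes \<open>2 t a + t\<^sup>2 q\<close>, where \<open>q\<close> is \<open>\<parallel>h\<parallel>\<^sup>2\<close> enlarged to be positive.\<close>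
    have "0 \<le> 2 * (- a / q) * a + (- a / q)\<^sup>2 * (nrm h)\<^sup>2"
      using var[OF h, of "- a / q"] by (simp add: a_def)
    also have "\<dots> \<le> 2 * (- a / q) * a + (- a / q)\<^sup>2 * q"
      by (intro add_left_mono mult_left_mono) (auto simp: q_def)
    also have "\<dots> = - (a\<^sup>2 / q)"
      using q by (simp add: field_simps power2_eq_square)
    finally have "a = 0" using q by (simp add: field_simps)
    then show ?thesis by (simp add: a_def)
  qed
  have "\<phi> x = ip x v" if x: "x \<in> V" for x
  proof -
    have "Re (\<phi> x) = Re (ip x v)"
      using Re[OF x] ip_commute[OF x vV] by simp
    moreover have "Im (\<phi> x) = Im (ip x v)"
      using Re[of "\<i> *\<^sub>C x"] x vV scale[of x \<i>] ip_commute[OF x vV] by simp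
    ultimately show ?thesis by (simp add: complex_eq_iff)
  qed
  then show ?thesis using vV that by blast
qed

text \<open>
  A closed subspace is a Hilbert space itself, and the projection of \<open>x\<close> represents the functional
  \<open>\<lambda>z. ip z x\<close> on it.
\<close>
lemma projection_exists:
  assumes L: "complex_vector.subspace L" "L \<subseteq> V"
    and closed: "\<And>X l. (\<And>k. X k \<in> L) \<Longrightarrow> hconverges H X l \<Longrightarrow> l \<in> L" and x: "x \<in> V"
  obtains y where "y \<in> L" "x - y \<in> orth_complement H L"
proof -
  let ?L = "\<lparr>hset = L, hinner = ip\<rparr>"
  have [simp]: "hnorm ?L = nrm" by (simp add: hnorm_def fun_eq_iff)
  have LV: "y \<in> V" if "y \<in> L" for y using L that by blast
  have "hilbert_space ?L"
    unfolding hilbert_space_def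
  proof (intro conjI allI impI)
    fix X assume X: "(\<forall>k. X k \<in> hset ?L) \<and> hCauchy ?L X"
    then obtain l where "hconverges H X l"
      using complete[of X] LV by (auto simp: hCauchy_def)
    then show "\<exists>l. hconverges ?L X l"
      using X closed[of X l] by (auto simp: hconverges_def)
  qed (auto simp: L LV Re_ip_pos intro: ip_commute)
  then interpret L: hilbert ?L by (rule hilbert.intro)
  obtain y where y: "y \<in> L" "\<And>z. z \<in> L \<Longrightarrow> ip z x = ip z y"
  proof (rule L.riesz[of "\<lambda>z. ip z x" "nrm x"])
    show "cmod (ip z x) \<le> nrm x * hnorm ?L z" if "z \<in> hset ?L" for z
      using cauchy_schwarz[of z x] that LV x by (simp add: mult.commute)
  qed (use LV x in auto)
  have "ip (x - y) z = 0" if "z \<in> L" for z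
    using y that LV x ip_commute[of "x - y" z] by (metis LV complex_cnj_cancel_iff complex_cnj_zero
        diff_mem eq_iff_diff_eq_0 ip_commute ip_diff_right)
  then show ?thesis
    using that y LV x by (auto simp: orth_complement_def)
qed

lemma adjoint_unique:
  assumes "x \<in> V" "\<And>h. h \<in> V \<Longrightarrow> hinner K (T h) y = ip h x"
  shows "adjoint_op H K T y = x"
  unfolding adjoint_op_def
proof (rule the_equality)
  fix x' assume "x' \<in> V \<and> (\<forall>h\<in>V. hinner K (T h) y = ip h x')"
  then show "x' = x" using assms by (intro eq_if_ip_eq) auto
qed (use assms in auto)

lemma orth_projection_eq:
  assumes L: "complex_vector.subspace L" "L \<subseteq> V" and y: "y \<in> L" "x - y \<in> orth_complement H L"
  shows "orth_projection H L x = y"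
  unfolding orth_projection_def
proof (rule the_equality)
  fix z assume z: "z \<in> L \<and> x - z \<in> orth_complement H L"
  then have d: "z - y \<in> L" using y L by (simp add: complex_vector.subspace_diff)
  have V: "z - y \<in> V" "x - y \<in> V" "x - z \<in> V" using d y z L by (auto simp: orth_complement_def)
  have "ip (x - y) (z - y) = 0" "ip (x - z) (z - y) = 0"
    using d y z by (auto simp: orth_complement_def)
  then have "ip ((x - y) - (x - z)) (z - y) = 0"
    using V by (simp only: ip_diff_left) simp
  then have "ip (z - y) (z - y) = 0" by simp
  then show "z = y" using Re_ip_pos[of "z - y"] V by fastforce
qed (use y in auto)

lemma subspace_orth_complement: "S \<subseteq> V \<Longrightarrow> complex_vector.subspace (orth_complement H S)"
  by (auto simp: complex_vector.subspace_def orth_complement_def subset_iff)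

lemma subset_double_orth_complement:
  assumes "S \<subseteq> V" shows "S \<subseteq> orth_complement H (orth_complement H S)"
proof
  fix x assume x: "x \<in> S"
  have "ip x y = 0" if "y \<in> orth_complement H S" for y
    using that x assms ip_commute[of y x] by (auto simp: orth_complement_def)
  then show "x \<in> orth_complement H (orth_complement H S)"
    using x assms by (auto simp: orth_complement_def)
qed

end

text \<open>Riesz representation of \<open>\<lambda>x. hinner K (T x) y\<close> for each \<open>y\<close>.\<close>
lemma adjoint_exists:
  assumes "hilbert_space H" "hilbert_space K" "bounded_operator H K T"
  obtains S where "bounded_operator K H S"
    "\<And>x y. x \<in> hset H \<Longrightarrow> y \<in> hset K \<Longrightarrow> hinner K (T x) y = hinner H x (S y)"
proof -
  interpret H: hilbert H by standard fact
  interpret K: hilbert K by standard fact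
  obtain C where C: "\<And>x. x \<in> H.V \<Longrightarrow> K.nrm (T x) \<le> C * H.nrm x"
    using assms(3) unfolding bounded_operator_def by blast
  have T: "T x \<in> K.V" "T (x + y) = T x + T y" "T (c *\<^sub>C x) = c *\<^sub>C T x"
    if "x \<in> H.V" "y \<in> H.V" for x y c
    using assms(3) that by (auto simp: bounded_operator_def)
  have "\<exists>v\<in>H.V. \<forall>x\<in>H.V. K.ip (T x) y = H.ip x v" if y: "y \<in> K.V" for y
  proof -
    have "cmod (K.ip (T x) y) \<le> (C * K.nrm y) * H.nrm x" if "x \<in> H.V" for x
      using K.cauchy_schwarz[OF T(1)[OF that that] y] mult_right_mono[OF C[OF that] K.nrm_nonneg[OF y]]
      by (simp add: algebra_simps)
    then show ?thesis
      by (rule H.riesz[of "\<lambda>x. K.ip (T x) y", rotated 2]) (use T y in auto)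
  qed
  then obtain S where S: "\<And>y. y \<in> K.V \<Longrightarrow> S y \<in> H.V"
    "\<And>x y. x \<in> H.V \<Longrightarrow> y \<in> K.V \<Longrightarrow> K.ip (T x) y = H.ip x (S y)"
    by metis
  have "bounded_operator K H S"
    unfolding bounded_operator_def
  proof (intro conjI ballI allI exI)
    show "S x \<in> H.V" if "x \<in> K.V" for x using S that by simp
    show "S (x + y) = S x + S y" if "x \<in> K.V" "y \<in> K.V" for x y
      using that S T by (intro H.eq_if_ip_eq) (auto simp flip: S(2))
    show "S (c *\<^sub>C x) = c *\<^sub>C S x" if "x \<in> K.V" for x c
      using that S T by (intro H.eq_if_ip_eq) (auto simp flip: S(2))
    show "H.nrm (S y) \<le> \<bar>C\<bar> * K.nrm y" if y: "y \<in> K.V" for y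
    proof -
      have "(H.nrm (S y))\<^sup>2 = Re (K.ip (T (S y)) y)"
        using S y by (simp add: H.nrm_sq)
      also have "\<dots> \<le> K.nrm (T (S y)) * K.nrm y"
        using K.cauchy_schwarz[OF T(1)[OF S(1) S(1)] y, OF y y]
          complex_Re_le_cmod[of "K.ip (T (S y)) y"] by linarith
      also have "\<dots> \<le> (C * H.nrm (S y)) * K.nrm y"
        using C S y by (intro mult_right_mono) auto
      also have "\<dots> \<le> (\<bar>C\<bar> * H.nrm (S y)) * K.nrm y"
        using S y by (intro mult_right_mono) auto
      finally have "H.nrm (S y) * H.nrm (S y) \<le> H.nrm (S y) * (\<bar>C\<bar> * K.nrm y)"
        by (simp add: power2_eq_square algebra_simps)
      then show ?thesis
        using S y H.nrm_nonneg[OF S(1)[OF y]] K.nrm_nonneg[OF y]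
        by (cases "H.nrm (S y) = 0") (auto simp: mult_le_cancel_left_pos)
    qed
  qed
  then show ?thesis using that S by blast
qed

section \<open>Bounded operators and hypercontractions\<close>

lemma bounded_operatorE:
  assumes "hilbert_space H" "bounded_operator H K T"
  obtains C where "0 \<le> C" "\<And>x. x \<in> hset H \<Longrightarrow> hnorm K (T x) \<le> C * hnorm H x"
proof -
  interpret H: hilbert H by (rule hilbert.intro) fact
  obtain C where C: "\<And>x. x \<in> H.V \<Longrightarrow> hnorm K (T x) \<le> C * H.nrm x"
    using assms(2) unfolding bounded_operator_def by blast
  have "hnorm K (T x) \<le> \<bar>C\<bar> * H.nrm x" if "x \<in> H.V" for x
    using C[OF that] mult_right_mono[OF abs_ge_self[of C] H.nrm_nonneg[OF that]] by linarith
  then show ?thesis using that abs_ge_zero by blast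
qed

lemma
  assumes "bounded_operator H K T"
  shows bounded_operator_mem: "x \<in> hset H \<Longrightarrow> T x \<in> hset K"
    and bounded_operator_add: "x \<in> hset H \<Longrightarrow> y \<in> hset H \<Longrightarrow> T (x + y) = T x + T y"
    and bounded_operator_scale: "x \<in> hset H \<Longrightarrow> T (c *\<^sub>C x) = c *\<^sub>C T x"
  using assms unfolding bounded_operator_def by blast+

lemma bounded_operator_diff:
  assumes "hilbert_space H" "bounded_operator H K T" "x \<in> hset H" "y \<in> hset H"
  shows "T (x - y) = T x - T y"
proof -
  interpret H: hilbert H by (rule hilbert.intro) fact
  have "T (x - y) + T y = T x"
    using bounded_operator_add[OF assms(2), of "x - y" y] assms by simp
  then show ?thesis by (simp add: algebra_simps)
qed

lemma bounded_operator_sum: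
  assumes "hilbert_space H" "bounded_operator H K T" "\<And>i. i \<in> I \<Longrightarrow> f i \<in> hset H"
  shows "T (sum f I) = (\<Sum>i\<in>I. T (f i))"
proof -
  interpret H: hilbert H by (rule hilbert.intro) fact
  have T0: "T 0 = 0" using bounded_operator_diff[OF assms(1,2), of 0 0] by simp
  show ?thesis
    using assms(3)
    by (induction I rule: infinite_finite_induct) (auto simp: T0 bounded_operator_add[OF assms(2)])
qed

lemma bounded_operator_cong:
  assumes "hilbert_space H" "\<And>x. x \<in> hset H \<Longrightarrow> T x = S x"
  shows "bounded_operator H K T \<longleftrightarrow> bounded_operator H K S"
proof -
  interpret H: hilbert H by (rule hilbert.intro) fact
  show ?thesis unfolding bounded_operator_def using assms(2) by simp
qed

lemma bounded_operator_compose: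
  assumes "hilbert_space H" "hilbert_space K"
    and T: "bounded_operator H K T" and S: "bounded_operator K L S"
  shows "bounded_operator H L (\<lambda>x. S (T x))"
proof -
  obtain C where C: "0 \<le> C" "\<And>x. x \<in> hset H \<Longrightarrow> hnorm K (T x) \<le> C * hnorm H x"
    using bounded_operatorE[OF assms(1) T] by blast
  obtain D where D: "0 \<le> D" "\<And>x. x \<in> hset K \<Longrightarrow> hnorm L (S x) \<le> D * hnorm K x"
    using bounded_operatorE[OF assms(2) S] by blast
  have "hnorm L (S (T x)) \<le> (D * C) * hnorm H x" if "x \<in> hset H" for x
    using D(2)[OF bounded_operator_mem[OF T that]] mult_left_mono[OF C(2)[OF that] D(1)]
    by (simp add: mult.assoc)
  then show ?thesis
    using T S unfolding bounded_operator_def by auto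
qed

lemma bounded_operator_pow:
  assumes H: "hilbert_space H" and T: "bounded_operator H H T"
  shows "bounded_operator H H (T ^^ k)"
proof (induction k)
  case 0
  show ?case unfolding bounded_operator_def by (auto intro: exI[of _ 1])
next
  case (Suc k)
  from bounded_operator_compose[OF H H this T] show ?case by (simp add: o_def)
qed

lemma bounded_operator_lincomb:
  assumes H: "hilbert_space H" and K: "hilbert_space K" and T: "\<And>j. bounded_operator H K (T j)"
    and I: "finite I"
  shows "bounded_operator H K (\<lambda>x. \<Sum>j\<in>I. c j *\<^sub>C T j x)"
proof -
  interpret H: hilbert H by (rule hilbert.intro) fact
  interpret K: hilbert K by (rule hilbert.intro) fact
  have "\<exists>C. \<forall>x\<in>hset H. hnorm K (T j x) \<le> C * hnorm H x" for j
    using T[of j] unfolding bounded_operator_def by blast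
  then obtain C where C: "\<And>j x. x \<in> hset H \<Longrightarrow> hnorm K (T j x) \<le> C j * hnorm H x"
    by metis
  note mem = bounded_operator_mem[OF T]
  have "hnorm K (\<Sum>j\<in>I. c j *\<^sub>C T j x) \<le> (\<Sum>j\<in>I. cmod (c j) * C j) * hnorm H x"
    if x: "x \<in> hset H" for x
  proof -
    have "hnorm K (\<Sum>j\<in>I. c j *\<^sub>C T j x) \<le> (\<Sum>j\<in>I. hnorm K (c j *\<^sub>C T j x))"
      by (rule K.nrm_sum) (simp add: mem x)
    also have "\<dots> \<le> (\<Sum>j\<in>I. cmod (c j) * (C j * hnorm H x))"
      using C x by (intro sum_mono) (simp add: K.nrm_scale mem mult_left_mono)
    finally show ?thesis by (simp add: sum_distrib_right mult.assoc)
  qed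
  moreover have "(\<Sum>j\<in>I. c j *\<^sub>C T j (x + y)) = (\<Sum>j\<in>I. c j *\<^sub>C T j x) + (\<Sum>j\<in>I. c j *\<^sub>C T j y)"
    if "x \<in> hset H" "y \<in> hset H" for x y
    using that by (simp add: bounded_operator_add[OF T] complex_vector.scale_right_distrib sum.distrib)
  moreover have "(\<Sum>j\<in>I. c j *\<^sub>C T j (a *\<^sub>C x)) = a *\<^sub>C (\<Sum>j\<in>I. c j *\<^sub>C T j x)"
    if "x \<in> hset H" for x a
    using that by (simp add: bounded_operator_scale[OF T] complex_vector.scale_sum_right mult.commute)
  ultimately show ?thesis
    unfolding bounded_operator_def using mem by (auto intro: K.sum_mem K.scale_mem)
qed

context hilbert
begin

lemma
  assumes T: "bounded_operator H H T"
  shows bounded_adjoint_op: "bounded_operator H H (adjoint_op H H T)"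
    and ip_adjoint_op: "x \<in> V \<Longrightarrow> y \<in> V \<Longrightarrow> ip (T x) y = ip x (adjoint_op H H T y)"
proof -
  obtain S where S: "bounded_operator H H S" "\<And>x y. x \<in> V \<Longrightarrow> y \<in> V \<Longrightarrow> ip (T x) y = ip x (S y)"
    using adjoint_exists[OF hilbert hilbert T] by blast
  have eq: "adjoint_op H H T y = S y" if "y \<in> V" for y
    using S that bounded_operator_mem by (intro adjoint_unique) blast+
  then show "x \<in> V \<Longrightarrow> y \<in> V \<Longrightarrow> ip (T x) y = ip x (adjoint_op H H T y)"
    using S by simp
  show "bounded_operator H H (adjoint_op H H T)"
    using S(1) bounded_operator_cong[where T = "adjoint_op H H T" and S = S, OF hilbert eq] by blast
qed

lemma ip_pow_adjoint:
  assumes T: "bounded_operator H H T" and S: "bounded_operator H H S"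
    and adj: "\<And>x y. x \<in> V \<Longrightarrow> y \<in> V \<Longrightarrow> ip (T x) y = ip x (S y)"
    and "x \<in> V" "y \<in> V"
  shows "ip ((T ^^ k) x) y = ip x ((S ^^ k) y)"
  using assms(4,5)
proof (induction k arbitrary: x)
  case (Suc k)
  have "ip ((T ^^ Suc k) x) y = ip ((T ^^ k) (T x)) y"
    by (simp add: funpow_swap1)
  also have "\<dots> = ip (T x) ((S ^^ k) y)"
    using Suc bounded_operator_mem[OF T] by simp
  also have "\<dots> = ip x ((S ^^ Suc k) y)"
    using Suc.prems bounded_operator_mem[OF bounded_operator_pow[OF hilbert S]] adj by simp
  finally show ?case .
qed simp

text \<open>The operators whose positivity defines hypercontractions.\<close>
definition hyperop :: "nat \<Rightarrow> ('a \<Rightarrow> 'a) \<Rightarrow> 'a \<Rightarrow> 'a"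
  where "hyperop k T x =
    (\<Sum>j\<le>k. ((-1) ^ j * of_nat (k choose j)) *\<^sub>C (adjoint_op H H T ^^ j) ((T ^^ j) x))"

lemma bounded_hyperop:
  assumes T: "bounded_operator H H T" shows "bounded_operator H H (hyperop k T)"
proof -
  have "bounded_operator H H (\<lambda>x. (adjoint_op H H T ^^ j) ((T ^^ j) x))" for j
    using bounded_operator_compose bounded_operator_pow bounded_adjoint_op T hilbert by metis
  then show ?thesis
    unfolding hyperop_def[abs_def] by (intro bounded_operator_lincomb hilbert) simp_all
qed

lemma ip_hyperop:
  assumes T: "bounded_operator H H T" and x: "x \<in> V" and y: "y \<in> V"
  shows "ip (hyperop k T x) y =
    (\<Sum>j\<le>k. (- 1) ^ j * of_nat (k choose j) * ip ((T ^^ j) x) ((T ^^ j) y))"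
proof -
  note S = bounded_adjoint_op[OF T]
  have mem: "(T ^^ j) z \<in> V" "(adjoint_op H H T ^^ j) ((T ^^ j) z) \<in> V" if "z \<in> V" for j z
    using bounded_operator_mem bounded_operator_pow T S that hilbert by metis+
  have "ip ((adjoint_op H H T ^^ j) ((T ^^ j) x)) y = ip ((T ^^ j) x) ((T ^^ j) y)" for j
  proof -
    have "ip ((adjoint_op H H T ^^ j) ((T ^^ j) x)) y = cnj (ip y ((adjoint_op H H T ^^ j) ((T ^^ j) x)))"
      using mem x y by (intro ip_commute) auto
    also have "\<dots> = cnj (ip ((T ^^ j) y) ((T ^^ j) x))"
      using ip_pow_adjoint[OF T S ip_adjoint_op[OF T], of y "(T ^^ j) x" j] mem x y by simp
    also have "\<dots> = ip ((T ^^ j) x) ((T ^^ j) y)"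
      using mem x y by (intro ip_commute[symmetric]) auto
    finally show ?thesis .
  qed
  then show ?thesis
    unfolding hyperop_def using mem x y by (simp add: ip_sum_left)
qed

lemma ip_hyperop_self:
  assumes T: "bounded_operator H H T" and x: "x \<in> V"
  shows "ip (hyperop k T x) x = of_real (hdiff k (\<lambda>j. (nrm ((T ^^ j) x))\<^sup>2))"
proof -
  have "(T ^^ j) x \<in> V" for j
    using bounded_operator_mem[OF bounded_operator_pow[OF hilbert T] x] .
  then show ?thesis
    by (simp add: ip_hyperop[OF T x x] ip_self hdiff_def)
qed

lemma ip_hyperop_symmetric:
  assumes T: "bounded_operator H H T" and x: "x \<in> V" and y: "y \<in> V"
  shows "ip (hyperop k T x) y = ip x (hyperop k T y)"
proof -
  have mem: "(T ^^ j) z \<in> V" if "z \<in> V" for j z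
    using bounded_operator_mem[OF bounded_operator_pow[OF hilbert T] that] .
  have comm: "cnj (ip ((T ^^ j) y) ((T ^^ j) x)) = ip ((T ^^ j) x) ((T ^^ j) y)" for j
    by (rule ip_commute[symmetric]) (rule mem, rule y, rule mem, rule x)
  have "ip x (hyperop k T y) = cnj (ip (hyperop k T y) x)"
    using bounded_operator_mem[OF bounded_hyperop[OF T] y] x by (intro ip_commute)
  also have "\<dots> = ip (hyperop k T x) y"
    unfolding ip_hyperop[OF T y x] ip_hyperop[OF T x y] cnj_sum
    by (intro sum.cong refl) (simp add: comm)
  finally show ?thesis by simp
qed

text \<open>
  The adjoint disappears from the quadratic form of \<open>hyperop\<close>, since \<open>\<langle>T\<^sup>*\<^sup>j T\<^sup>j x, x\<rangle> = \<parallel>T\<^sup>j x\<parallel>\<^sup>2\<close>.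
\<close>
lemma hypercontraction_iff:
  assumes T: "bounded_operator H H T"
  shows "hypercontraction n H T \<longleftrightarrow>
    (\<forall>k\<le>n. \<forall>x\<in>V. 0 \<le> hdiff k (\<lambda>j. (nrm ((T ^^ j) x))\<^sup>2))"
proof -
  have "positive_operator H (hyperop k T) \<longleftrightarrow> (\<forall>x\<in>V. 0 \<le> hdiff k (\<lambda>j. (nrm ((T ^^ j) x))\<^sup>2))" for k
    unfolding positive_operator_def using bounded_hyperop[OF T] by (simp add: ip_hyperop_self[OF T])
  then show ?thesis
    unfolding hypercontraction_def using T by (simp add: hyperop_def[abs_def])
qed

end

section \<open>Square roots of positive operators\<close>

text \<open>The Taylor coefficients of \<open>\<surd>(1 - z)\<close>.\<close>
definition sqrt_coeff :: "nat \<Rightarrow> real"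
  where "sqrt_coeff k = (- 1) ^ k * ((1 / 2) gchoose k)"

lemma sqrt_coeff_pochhammer: "sqrt_coeff k = pochhammer (- 1 / 2) k / fact k"
  by (simp add: sqrt_coeff_def gbinomial_pochhammer flip: power_mult_distrib mult.assoc)

lemma sqrt_coeff_0 [simp]: "sqrt_coeff 0 = 1"
  by (simp add: sqrt_coeff_def)

lemma sqrt_coeff_Suc_nonpos: "sqrt_coeff (Suc k) \<le> 0"
  unfolding sqrt_coeff_pochhammer pochhammer_rec
  by (intro divide_nonpos_nonneg mult_nonpos_nonneg pochhammer_nonneg) auto

text \<open>The partial sums are the Taylor coefficients of \<open>\<surd>(1 - z) / (1 - z) = (1 - z)\<^sup>-\<^sup>1\<^sup>/\<^sup>2\<close>.\<close>
lemma sqrt_coeff_sum_nonneg: "0 \<le> (\<Sum>k\<le>N. sqrt_coeff k)"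
proof -
  have "(\<Sum>k\<le>N. sqrt_coeff k) = (- 1) ^ N * ((1 / 2 - 1 :: real) gchoose N)"
    unfolding sqrt_coeff_def using gbinomial_sum_lower_neg[of "1/2 :: real" N] by (simp add: mult.commute)
  also have "\<dots> = pochhammer (1 / 2) N / fact N"
    by (simp add: gbinomial_pochhammer flip: power_mult_distrib mult.assoc)
  also have "\<dots> \<ge> 0"
    by (intro divide_nonneg_nonneg pochhammer_nonneg) auto
  finally show ?thesis .
qed

text \<open>
  All coefficients but the first are nonpositive, so a partial sum of absolute values is \<open>2\<close> minus the
  corresponding partial sum of the coefficients.
\<close>
lemma summable_abs_sqrt_coeff: "summable (\<lambda>k. \<bar>sqrt_coeff k\<bar>)"
proof (rule summableI_nonneg_bounded)
  have *: "(\<Sum>k\<le>N. \<bar>sqrt_coeff k\<bar>) = 2 - (\<Sum>k\<le>N. sqrt_coeff k)" for N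
    by (induction N) (use sqrt_coeff_Suc_nonpos in auto)
  show "(\<Sum>k<N. \<bar>sqrt_coeff k\<bar>) \<le> 2" for N
  proof -
    have "(\<Sum>k<N. \<bar>sqrt_coeff k\<bar>) \<le> (\<Sum>k\<le>N. \<bar>sqrt_coeff k\<bar>)"
      by (intro sum_mono2) auto
    then show ?thesis using *[of N] sqrt_coeff_sum_nonneg[of N] by simp
  qed
qed simp

text \<open>The square of the series is \<open>1 - z\<close>.\<close>
lemma sqrt_coeff_convolution: "(\<Sum>i\<le>k. sqrt_coeff i * sqrt_coeff (k - i)) = (if k = 0 then 1 else if k = 1 then - 1 else 0)"
proof -
  have "(\<Sum>i\<le>k. sqrt_coeff i * sqrt_coeff (k - i)) = (- 1) ^ k * (\<Sum>i\<le>k. ((1/2) gchoose i) * ((1/2) gchoose (k - i)))"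
    unfolding sum_distrib_left
  proof (intro sum.cong refl)
    fix i assume "i \<in> {..k}"
    then have "(- 1) ^ k = (- 1) ^ i * (- 1 :: real) ^ (k - i)"
      by (simp flip: power_add)
    then show "sqrt_coeff i * sqrt_coeff (k - i) = (- 1) ^ k * (((1/2) gchoose i) * ((1/2) gchoose (k - i)))"
      by (simp add: sqrt_coeff_def)
  qed
  also have "(\<Sum>i\<le>k. ((1/2) gchoose i) * ((1/2) gchoose (k - i))) = ((1/2 + 1/2 :: real) gchoose k)"
    using gbinomial_Vandermonde[of "1/2 :: real" "1/2" k] by (simp add: atMost_atLeast0)
  also have "\<dots> = real (1 choose k)"
    by (simp add: binomial_gbinomial)
  finally show ?thesis
    by (cases k rule: nat.exhaust; cases "k - 1") (auto simp: binomial_eq_0)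
qed

context hilbert
begin

text \<open>
  Positivity of \<open>G\<close> at \<open>y = x - G x / c\<close> gives \<open>\<parallel>G x\<parallel>\<^sup>2 \<le> c \<langle>G x, x\<rangle>\<close>, and expanding \<open>\<parallel>y\<parallel>\<^sup>2\<close> then yields
  \<open>\<parallel>y\<parallel>\<^sup>2 \<le> \<parallel>x\<parallel>\<^sup>2 - \<langle>G x, x\<rangle> / c\<close>.
\<close>
lemma positive_contraction_complement:
  assumes G: "bounded_operator H H G" and sym: "\<And>x y. x \<in> V \<Longrightarrow> y \<in> V \<Longrightarrow> ip (G x) y = ip x (G y)"
    and pos: "\<And>x. x \<in> V \<Longrightarrow> 0 \<le> Re (ip (G x) x)"
    and c: "0 < c" "\<And>x. x \<in> V \<Longrightarrow> nrm (G x) \<le> c * nrm x"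
    and x: "x \<in> V"
  shows "nrm (x - of_real (1 / c) *\<^sub>C G x) \<le> nrm x"
proof -
  note Gm = bounded_operator_mem[OF G]
  let ?t = "1 / c"
  have Gx: "G x \<in> V" and GGx: "G (G x) \<in> V" using x Gm by auto
  define y where "y = x - of_real ?t *\<^sub>C G x"
  have y: "y \<in> V" using x Gx by (simp add: y_def)
  have G_y: "G y = G x - of_real ?t *\<^sub>C G (G x)"
    unfolding y_def using x Gx by (simp only: bounded_operator_diff[OF hilbert G] bounded_operator_scale[OF G] scale_mem)
  have "Re (ip (G (G x)) (G x)) \<le> nrm (G (G x)) * nrm (G x)"
    using cauchy_schwarz[OF GGx Gx] complex_Re_le_cmod order_trans by blast
  also have "\<dots> \<le> (c * nrm (G x)) * nrm (G x)"
    using c(2)[OF Gx] Gx by (intro mult_right_mono) auto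
  finally have q: "Re (ip (G (G x)) (G x)) \<le> c * (nrm (G x))\<^sup>2"
    by (simp add: power2_eq_square mult.assoc)
  have s: "ip (G (G x)) x = of_real ((nrm (G x))\<^sup>2)"
    using sym[OF Gx x] Gx by (simp add: ip_self)
  have "Re (ip (G y) y) = Re (ip (G x) x) - 2 * ?t * (nrm (G x))\<^sup>2 + ?t * ?t * Re (ip (G (G x)) (G x))"
    unfolding G_y unfolding y_def using x Gx GGx s
    by (simp add: ip_self algebra_simps)
  moreover have "?t * ?t * Re (ip (G (G x)) (G x)) \<le> ?t * ?t * (c * (nrm (G x))\<^sup>2)"
    using q c(1) by (intro mult_left_mono) auto
  moreover have "?t * ?t * (c * (nrm (G x))\<^sup>2) = ?t * (nrm (G x))\<^sup>2"
    using c(1) by simp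
  ultimately have *: "?t * (nrm (G x))\<^sup>2 \<le> Re (ip (G x) x)"
    using pos[OF y] by linarith
  have "(nrm (x - of_real ?t *\<^sub>C G x))\<^sup>2 = (nrm x)\<^sup>2 - 2 * ?t * Re (ip (G x) x) + ?t * (?t * (nrm (G x))\<^sup>2)"
    unfolding nrm_sq_diff[OF x scale_mem[OF Gx]] using x Gx c(1) sym[OF x x, symmetric]
    by (simp add: nrm_scale norm_divide power_divide power2_eq_square)
  also have "\<dots> \<le> (nrm x)\<^sup>2 - 2 * ?t * Re (ip (G x) x) + ?t * Re (ip (G x) x)"
    using * c(1) by (intro add_left_mono mult_left_mono) auto
  also have "\<dots> = (nrm x)\<^sup>2 - ?t * Re (ip (G x) x)" by simp
  also have "\<dots> \<le> (nrm x)\<^sup>2"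
    using pos[OF x] c(1) by simp
  finally show ?thesis
    by (rule power2_le_imp_le) (simp add: x)
qed

text \<open>
  The operator \<open>\<surd>(1 - C)\<close> is the binomial series in the contraction \<open>C\<close>; it converges in norm since the
  coefficients are absolutely summable even on the boundary of the disk.  As \<open>C\<close> is self-adjoint,
  \<open>\<langle>C\<^sup>i x, C\<^sup>j x\<rangle>\<close> only depends on \<open>i + j\<close>, so \<open>\<parallel>D x\<parallel>\<^sup>2\<close> is a limit of scalar double sums over squares.
  Over triangles the corresponding sums are exact by the convolution identity, and the difference
  between squares and triangles tends to \<open>0\<close> by the Cauchy product theorem for the absolute values.
\<close>
lemma sqrt_one_minus:
  assumes C: "bounded_operator H H C" and sym: "\<And>x y. x \<in> V \<Longrightarrow> y \<in> V \<Longrightarrow> ip (C x) y = ip x (C y)"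
    and le: "\<And>x. x \<in> V \<Longrightarrow> nrm (C x) \<le> nrm x"
  obtains D where "bounded_operator H H D" "\<And>x. x \<in> V \<Longrightarrow> (nrm (D x))\<^sup>2 = Re (ip (x - C x) x)"
proof -
  note Cp = bounded_operator_pow[OF hilbert C]
  have pm: "(C ^^ k) x \<in> V" if "x \<in> V" for k x
    using bounded_operator_mem[OF Cp that] .
  have pn: "nrm ((C ^^ k) x) \<le> nrm x" if "x \<in> V" for k x
  proof (induction k)
    case (Suc k)
    then show ?case using le[OF pm[OF that], of k] by simp
  qed simp
  let ?P = "\<lambda>N x. \<Sum>k<N. of_real (sqrt_coeff k) *\<^sub>C (C ^^ k) x"
  have P: "bounded_operator H H (?P N)" for N
    by (rule bounded_operator_lincomb[OF hilbert hilbert Cp]) simp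
  note Pm = bounded_operator_mem[OF P]
  have "\<exists>l. hconverges H (\<lambda>N. ?P N x) l \<and> nrm l \<le> (\<Sum>k. \<bar>sqrt_coeff k\<bar>) * nrm x" if x: "x \<in> V" for x
  proof -
    have s: "summable (\<lambda>k. \<bar>sqrt_coeff k\<bar> * nrm x)"
      by (intro summable_mult2 summable_abs_sqrt_coeff)
    have b: "nrm (of_real (sqrt_coeff k) *\<^sub>C (C ^^ k) x) \<le> \<bar>sqrt_coeff k\<bar> * nrm x" for k
      using pm[OF x] pn[OF x] by (simp add: nrm_scale mult_left_mono)
    have m: "of_real (sqrt_coeff k) *\<^sub>C (C ^^ k) x \<in> V" for k
      using pm[OF x] by simp
    have "suminf (\<lambda>k. \<bar>sqrt_coeff k\<bar> * nrm x) = (\<Sum>k. \<bar>sqrt_coeff k\<bar>) * nrm x"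
      by (intro suminf_mult2[symmetric] summable_abs_sqrt_coeff)
    then show ?thesis
      using abs_summable_hconverges[OF m s b] by metis
  qed
  then obtain D where D: "\<And>x. x \<in> V \<Longrightarrow> hconverges H (\<lambda>N. ?P N x) (D x)"
    "\<And>x. x \<in> V \<Longrightarrow> nrm (D x) \<le> (\<Sum>k. \<bar>sqrt_coeff k\<bar>) * nrm x"
    by metis
  have "bounded_operator H H D"
    unfolding bounded_operator_def
  proof (intro conjI ballI allI exI)
    fix x assume x: "x \<in> V"
    show "D x \<in> V" using D(1)[OF x] by (simp add: hconverges_def)
    show "nrm (D x) \<le> (\<Sum>k. \<bar>sqrt_coeff k\<bar>) * nrm x" by (rule D(2)[OF x])
    show "D (c *\<^sub>C x) = c *\<^sub>C D x" for c
    proof (rule hconverges_unique)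
      show "hconverges H (\<lambda>N. ?P N (c *\<^sub>C x)) (D (c *\<^sub>C x))" by (rule D(1)) (simp add: x)
      show "hconverges H (\<lambda>N. ?P N (c *\<^sub>C x)) (c *\<^sub>C D x)"
        using hconverges_scale[OF Pm[OF x] D(1)[OF x], of c] bounded_operator_scale[OF P x] by simp
    qed (rule Pm, simp add: x)
    show "D (x + y) = D x + D y" if y: "y \<in> V" for y
    proof (rule hconverges_unique)
      show "hconverges H (\<lambda>N. ?P N (x + y)) (D (x + y))" by (rule D(1)) (simp add: x y)
      show "hconverges H (\<lambda>N. ?P N (x + y)) (D x + D y)"
        using hconverges_add[OF Pm[OF x] Pm[OF y] D(1)[OF x] D(1)[OF y]] bounded_operator_add[OF P x y]
        by simp
    qed (rule Pm, simp add: x y)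
  qed
  moreover have "(nrm (D x))\<^sup>2 = Re (ip (x - C x) x)" if x: "x \<in> V" for x
  proof -
    define s where "s m = Re (ip ((C ^^ m) x) x)" for m
    have sb: "\<bar>s m\<bar> \<le> (nrm x)\<^sup>2" for m
    proof -
      have "\<bar>s m\<bar> \<le> cmod (ip ((C ^^ m) x) x)" unfolding s_def by (rule abs_Re_le_cmod)
      also have "\<dots> \<le> nrm ((C ^^ m) x) * nrm x" by (rule cauchy_schwarz[OF pm[OF x] x])
      also have "\<dots> \<le> nrm x * nrm x" using pn[OF x] x by (intro mult_right_mono) auto
      finally show ?thesis by (simp add: power2_eq_square)
    qed
    have s: "Re (ip ((C ^^ i) x) ((C ^^ j) x)) = s (i + j)" for i j
      using ip_pow_adjoint[OF C C sym, of "(C ^^ i) x" x j] pm[OF x] x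
      unfolding s_def by (simp add: funpow_add add.commute[of i j])
    let ?sq = "\<lambda>N. {..<N} \<times> {..<N :: nat}" and ?tr = "\<lambda>N. {(i, j). i + j < (N::nat)}"
    have sub: "?tr N \<subseteq> ?sq N" for N by auto
    have finsq: "finite (?sq N)" for N by simp
    have fintr: "finite (?tr N)" for N using finite_subset[OF sub finsq] .
    have sqN: "(nrm (?P N x))\<^sup>2 = (\<Sum>(i,j)\<in>?sq N. sqrt_coeff i * sqrt_coeff j * s (i + j))" for N
    proof -
      have "ip (?P N x) (?P N x) =
          (\<Sum>i<N. \<Sum>j<N. of_real (sqrt_coeff i * sqrt_coeff j) * ip ((C ^^ i) x) ((C ^^ j) x))"
        using pm[OF x] Pm[OF x, of N]
        by (subst ip_sum_left) (simp_all add: ip_sum_right mult.assoc mult.left_commute sum_distrib_left)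
      then have "(nrm (?P N x))\<^sup>2 = (\<Sum>i<N. \<Sum>j<N. sqrt_coeff i * sqrt_coeff j * s (i + j))"
        using Pm[OF x] by (simp add: nrm_sq s del: of_real_mult)
      then show ?thesis by (simp add: sum.cartesian_product)
    qed
    have trN: "(\<Sum>(i,j)\<in>?tr N. sqrt_coeff i * sqrt_coeff j * s (i + j)) = s 0 - s 1" if "N \<ge> 2" for N
    proof -
      have "(\<Sum>(i,j)\<in>?tr N. sqrt_coeff i * sqrt_coeff j * s (i + j)) =
          (\<Sum>k<N. \<Sum>i\<le>k. sqrt_coeff i * sqrt_coeff (k - i) * s (i + (k - i)))"
        by (rule sum.triangle_reindex)
      also have "\<dots> = (\<Sum>k<N. (\<Sum>i\<le>k. sqrt_coeff i * sqrt_coeff (k - i)) * s k)"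
        by (intro sum.cong refl) (simp add: sum_distrib_right)
      also have "\<dots> = (\<Sum>k\<in>{0, 1}. (\<Sum>i\<le>k. sqrt_coeff i * sqrt_coeff (k - i)) * s k)"
        using that by (intro sum.mono_neutral_right) (auto simp: sqrt_coeff_convolution)
      also have "\<dots> = s 0 - s 1" by (simp add: sqrt_coeff_convolution)
      finally show ?thesis .
    qed
    \<comment> \<open>The sum of the absolute values over the part of the square outside the triangle.\<close>
    let ?E = "\<lambda>N. (\<Sum>i<N. \<bar>sqrt_coeff i\<bar>) * (\<Sum>i<N. \<bar>sqrt_coeff i\<bar>) - (\<Sum>k<N. \<Sum>i\<le>k. \<bar>sqrt_coeff i\<bar> * \<bar>sqrt_coeff (k - i)\<bar>)"
    have E: "?E N = (\<Sum>(i,j)\<in>?sq N - ?tr N. \<bar>sqrt_coeff i\<bar> * \<bar>sqrt_coeff j\<bar>)" for N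
      using sum.triangle_reindex[of "\<lambda>i j. \<bar>sqrt_coeff i\<bar> * \<bar>sqrt_coeff j\<bar>" N]
      by (simp add: sum_diff[OF finsq sub] sum_product sum.cartesian_product)
    have "\<bar>(nrm (?P N x))\<^sup>2 - (s 0 - s 1)\<bar> \<le> (nrm x)\<^sup>2 * ?E N" if N: "N \<ge> 2" for N
    proof -
      have "(nrm (?P N x))\<^sup>2 - (s 0 - s 1) = (\<Sum>(i,j)\<in>?sq N - ?tr N. sqrt_coeff i * sqrt_coeff j * s (i + j))"
        unfolding sqN trN[OF N, symmetric] by (simp add: sum_diff[OF finsq sub])
      also have "\<bar>\<dots>\<bar> \<le> (\<Sum>(i,j)\<in>?sq N - ?tr N. (nrm x)\<^sup>2 * (\<bar>sqrt_coeff i\<bar> * \<bar>sqrt_coeff j\<bar>))"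
      proof (rule order_trans[OF sum_abs], rule sum_mono)
        fix p :: "nat \<times> nat"
        obtain i j where p: "p = (i, j)" by (cases p)
        have "\<bar>sqrt_coeff i * sqrt_coeff j * s (i + j)\<bar> = \<bar>sqrt_coeff i\<bar> * \<bar>sqrt_coeff j\<bar> * \<bar>s (i + j)\<bar>"
          by (simp add: abs_mult)
        also have "\<dots> \<le> \<bar>sqrt_coeff i\<bar> * \<bar>sqrt_coeff j\<bar> * (nrm x)\<^sup>2"
          by (intro mult_left_mono sb) simp
        also have "\<dots> = (nrm x)\<^sup>2 * (\<bar>sqrt_coeff i\<bar> * \<bar>sqrt_coeff j\<bar>)"
          by (rule mult.commute)
        finally show "\<bar>case p of (i, j) \<Rightarrow> sqrt_coeff i * sqrt_coeff j * s (i + j)\<bar>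
            \<le> (case p of (i, j) \<Rightarrow> (nrm x)\<^sup>2 * (\<bar>sqrt_coeff i\<bar> * \<bar>sqrt_coeff j\<bar>))"
          by (simp only: p prod.case)
      qed
      also have "\<dots> = (nrm x)\<^sup>2 * ?E N"
        unfolding E by (simp add: sum_distrib_left case_prod_unfold)
      finally show ?thesis .
    qed
    moreover have "(\<lambda>N. (nrm x)\<^sup>2 * ?E N) \<longlonglongrightarrow> (nrm x)\<^sup>2 * ((\<Sum>k. \<bar>sqrt_coeff k\<bar>) * (\<Sum>k. \<bar>sqrt_coeff k\<bar>) - (\<Sum>k. \<bar>sqrt_coeff k\<bar>) * (\<Sum>k. \<bar>sqrt_coeff k\<bar>))"
    proof (intro tendsto_intros summable_LIMSEQ summable_abs_sqrt_coeff)
      show "(\<lambda>N. \<Sum>k<N. \<Sum>i\<le>k. \<bar>sqrt_coeff i\<bar> * \<bar>sqrt_coeff (k - i)\<bar>) \<longlonglongrightarrow> (\<Sum>k. \<bar>sqrt_coeff k\<bar>) * (\<Sum>k. \<bar>sqrt_coeff k\<bar>)"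
        using Cauchy_product_sums[of "\<lambda>k. \<bar>sqrt_coeff k\<bar>" "\<lambda>k. \<bar>sqrt_coeff k\<bar>"] summable_abs_sqrt_coeff
        by (simp add: sums_def)
    qed
    ultimately have "(\<lambda>N. (nrm (?P N x))\<^sup>2 - (s 0 - s 1)) \<longlonglongrightarrow> 0"
      by (intro Lim_null_comparison[of "\<lambda>N. (nrm (?P N x))\<^sup>2 - (s 0 - s 1)" "\<lambda>N. (nrm x)\<^sup>2 * ?E N"])
        (auto simp: eventually_sequentially)
    then have "(\<lambda>N. (nrm (?P N x))\<^sup>2) \<longlonglongrightarrow> s 0 - s 1"
      by (simp only: LIM_zero_iff)
    moreover have "(\<lambda>N. (nrm (?P N x))\<^sup>2) \<longlonglongrightarrow> (nrm (D x))\<^sup>2"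
      by (intro tendsto_power tendsto_nrm[OF Pm[OF x] D(1)[OF x]])
    ultimately have "(nrm (D x))\<^sup>2 = s 0 - s 1"
      using LIMSEQ_unique by blast
    then show ?thesis
      using x bounded_operator_mem[OF C x] by (simp add: s_def)
  qed
  ultimately show ?thesis using that by blast
qed

text \<open>
  Scale \<open>G\<close> by a bound \<open>c\<close> for its norm and apply the binomial series to \<open>C = 1 - G / c\<close>.  The
  operator \<open>d\<close> is a square root of \<open>G\<close> in the sense that \<open>d\<^sup>* d\<close> has the quadratic form of \<open>G\<close>.
\<close>
lemma positive_operator_sqrt:
  assumes G: "bounded_operator H H G" and sym: "\<And>x y. x \<in> V \<Longrightarrow> y \<in> V \<Longrightarrow> ip (G x) y = ip x (G y)"
    and pos: "\<And>x. x \<in> V \<Longrightarrow> 0 \<le> Re (ip (G x) x)"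
  obtains d where "bounded_operator H H d" "\<And>x. x \<in> V \<Longrightarrow> (nrm (d x))\<^sup>2 = Re (ip (G x) x)"
proof -
  obtain c0 where c0: "0 \<le> c0" "\<And>x. x \<in> V \<Longrightarrow> nrm (G x) \<le> c0 * nrm x"
    using bounded_operatorE[OF hilbert G] by blast
  define c where "c = c0 + 1"
  have c: "0 < c" "\<And>x. x \<in> V \<Longrightarrow> nrm (G x) \<le> c * nrm x"
    using c0 by (auto simp: c_def distrib_right intro: add_increasing2)
  define C where "C x = x - of_real (1 / c) *\<^sub>C G x" for x
  note Gm = bounded_operator_mem[OF G]
  have le: "nrm (C x) \<le> nrm x" if "x \<in> V" for x
    unfolding C_def by (rule positive_contraction_complement[OF G sym pos c that])
  have C: "bounded_operator H H C"
    unfolding bounded_operator_def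
  proof (intro conjI ballI allI exI[of _ 1])
    fix x assume x: "x \<in> V"
    show "C x \<in> V" using x Gm by (simp add: C_def)
    show "nrm (C x) \<le> 1 * nrm x" using le[OF x] by simp
    show "C (a *\<^sub>C x) = a *\<^sub>C C x" for a
      unfolding C_def bounded_operator_scale[OF G x]
      by (simp add: complex_vector.scale_right_diff_distrib mult.commute)
    show "C (x + y) = C x + C y" if "y \<in> V" for y
      unfolding C_def bounded_operator_add[OF G x that]
      by (simp add: complex_vector.scale_right_distrib)
  qed
  have Csym: "ip (C x) y = ip x (C y)" if "x \<in> V" "y \<in> V" for x y
    using that Gm sym[OF that] by (simp add: C_def)
  obtain D where D: "bounded_operator H H D" "\<And>x. x \<in> V \<Longrightarrow> (nrm (D x))\<^sup>2 = Re (ip (x - C x) x)"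
    using sqrt_one_minus[OF C Csym le] by blast
  let ?d = "\<lambda>x. of_real (sqrt c) *\<^sub>C D x"
  have "bounded_operator H H ?d"
    using bounded_operator_lincomb[OF hilbert hilbert, of "\<lambda>_. D" "{0::nat}" "\<lambda>_. of_real (sqrt c)"] D(1)
    by simp
  moreover have "(nrm (?d x))\<^sup>2 = Re (ip (G x) x)" if x: "x \<in> V" for x
  proof -
    have "(nrm (?d x))\<^sup>2 = c * (nrm (D x))\<^sup>2"
      using bounded_operator_mem[OF D(1) x] c(1) by (simp add: nrm_scale power_mult_distrib)
    also have "\<dots> = Re (ip (G x) x)"
      using D(2)[OF x] c(1) x Gm by (simp add: C_def)
    finally show ?thesis .
  qed
  ultimately show ?thesis by (rule that)
qed

end

section \<open>The weighted Bergman space\<close>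

text \<open>Identity theorem for power series.\<close>
lemma powser_zero_imp_coeff_zero:
  fixes b :: "nat \<Rightarrow> complex"
  assumes "\<And>z. cmod z < 1 \<Longrightarrow> (\<lambda>j. b j * z ^ j) sums 0"
  shows "b j = 0"
proof -
  let ?F = "Abs_fps b"
  have "summable (\<lambda>j. fps_nth ?F j * (1/2) ^ j)"
    using assms[of "1/2"] by (simp add: sums_iff norm_divide)
  then have "fps_conv_radius ?F \<ge> norm (1/2 :: complex)"
    unfolding fps_conv_radius_def by (rule conv_radius_geI)
  then have "fps_conv_radius ?F > 0"
    by (rule less_le_trans[rotated]) (simp add: norm_divide)
  moreover have "eventually (\<lambda>z. eval_fps ?F z = eval_fps 0 z) (nhds 0)"
  proof -
    have "eventually (\<lambda>z. z \<in> ball (0::complex) 1) (nhds 0)"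
      by (intro eventually_nhds_in_open) auto
    then show ?thesis
      by eventually_elim (use assms in \<open>auto simp: eval_fps_def sums_iff\<close>)
  qed
  ultimately have "?F = 0"
    by (intro eval_fps_eqD) auto
  then show ?thesis
    by (metis fps_nth_Abs_fps fps_zero_nth)
qed

lemma sums_Suc_if_zero:
  fixes f :: "nat \<Rightarrow> 'a::real_normed_vector"
  shows "f sums s \<Longrightarrow> f 0 = 0 \<Longrightarrow> (\<lambda>j. f (Suc j)) sums s"
  by (simp add: sums_Suc_iff)

text \<open>The function on the disk with given Taylor coefficients; it vanishes off the disk, as required of
  members of the Bergman space.\<close>
definition of_coeffs :: "'y::complex_vector hspace \<Rightarrow> (nat \<Rightarrow> 'y) \<Rightarrow> complex \<Rightarrow> 'y"
  where "of_coeffs Y a z =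
    (if z \<in> ball 0 1 then THE l. hconverges Y (\<lambda>N. \<Sum>j<N. z ^ j *\<^sub>C a j) l else 0)"

text \<open>The adjoint of the shift on the Bergman space, see \<open>ip_shift\<close>.\<close>
definition backshift :: "nat \<Rightarrow> 'y::complex_vector hspace \<Rightarrow> (complex \<Rightarrow> 'y) \<Rightarrow> complex \<Rightarrow> 'y"
  where "backshift n Y f =
    of_coeffs Y (\<lambda>j. of_real (mu n (Suc j) / mu n j) *\<^sub>C taylor_coeff Y f (Suc j))"

locale bergman_space = Y: hilbert Y for Y :: "'y::complex_vector hspace" +
  fixes n :: nat
  assumes n: "1 \<le> n"
begin

abbreviation A :: "(complex \<Rightarrow> 'y) hspace" where "A \<equiv> bergman n Y"
abbreviation coeff :: "(complex \<Rightarrow> 'y) \<Rightarrow> nat \<Rightarrow> 'y" where "coeff \<equiv> taylor_coeff Y"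

lemma mu_pos [simp]: "0 < mu n j"
  using rho_ge_1[OF n, of j] by (simp add: mu_rho)

lemma mu_nonneg [simp]: "0 \<le> mu n j"
  using mu_pos[of j] by (simp del: mu_pos)

lemma mu_nz [simp]: "mu n j \<noteq> 0"
  using mu_pos[of j] by (simp del: mu_pos)

lemma mu_antimono: "i \<le> j \<Longrightarrow> mu n j \<le> mu n i"
  using rho_mono_right[OF n, of i j] rho_ge_1[OF n, of i] by (simp add: mu_rho frac_le)

text \<open>Pairing with a vector of \<open>Y\<close> reduces uniqueness to scalar power series.\<close>
lemma disk_series_unique:
  assumes "disk_series Y a f" "disk_series Y b f" shows "a = b"
proof
  fix j
  have V: "a j \<in> Y.V" "b j \<in> Y.V" for j using assms by (auto simp: disk_series_def)
  have "Y.ip (a j - b j) y = 0" if y: "y \<in> Y.V" for y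
  proof (rule powser_zero_imp_coeff_zero[of "\<lambda>j. Y.ip (a j - b j) y"])
    fix z :: complex assume z: "cmod z < 1"
    let ?X = "\<lambda>c N. \<Sum>j<N. z ^ j *\<^sub>C c j"
    have "hconverges Y (\<lambda>N. ?X a N - ?X b N) (f z - f z)"
      using assms z V by (intro Y.hconverges_diff) (auto simp: disk_series_def)
    moreover have "?X a N - ?X b N = ?X (\<lambda>j. a j - b j) N" for N
      by (simp add: sum_subtractf complex_vector.scale_right_diff_distrib)
    ultimately have "hconverges Y (?X (\<lambda>j. a j - b j)) 0"
      by simp
    then have "(\<lambda>N. Y.ip (?X (\<lambda>j. a j - b j) N) y) \<longlonglongrightarrow> Y.ip 0 y"
      using V y by (intro Y.tendsto_ip) auto
    moreover have "Y.ip (?X (\<lambda>j. a j - b j) N) y = (\<Sum>j<N. Y.ip (a j - b j) y * z ^ j)" for N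
      using V y by (subst Y.ip_sum_left) (auto simp: mult.commute simp del: Y.ip_diff_left)
    ultimately show "(\<lambda>j. Y.ip (a j - b j) y * z ^ j) sums 0"
      using y by (simp add: sums_def)
  qed
  then show "a j = b j"
    using V by (intro Y.eq_if_ip_eq_left) auto
qed

lemma coeff_eq: "disk_series Y a f \<Longrightarrow> coeff f = a"
  unfolding taylor_coeff_def using disk_series_unique by blast

lemma memI:
  "disk_series Y a f \<Longrightarrow> summable (\<lambda>j. mu n j * (Y.nrm (a j))\<^sup>2) \<Longrightarrow> f \<in> hset A"
  by (auto simp: bergman_def)

lemma
  assumes "f \<in> hset A"
  shows disk_series_coeff: "disk_series Y (coeff f) f"
    and summable_coeff: "summable (\<lambda>j. mu n j * (Y.nrm (coeff f j))\<^sup>2)"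
    and coeff_mem [simp]: "coeff f j \<in> Y.V"
  using assms coeff_eq by (auto simp: bergman_def disk_series_def)

lemma mem_eval [simp]: "f \<in> hset A \<Longrightarrow> f z \<in> Y.V"
  using disk_series_coeff[of f] by (cases "z \<in> ball 0 1") (auto simp: disk_series_def hconverges_def)

lemma disk_series_fun_eq: 
  assumes "disk_series Y a f" "disk_series Y a g" shows "f = g"
proof
  fix z
  have V: "a j \<in> Y.V" for j using assms by (auto simp: disk_series_def)
  show "f z = g z"
  proof (cases "z \<in> ball 0 1")
    case True
    then show ?thesis
      using assms V by (intro Y.hconverges_unique[of "\<lambda>N. \<Sum>j<N. z ^ j *\<^sub>C a j"])
        (auto simp: disk_series_def)
  qed (use assms in \<open>simp add: disk_series_def\<close>)
qed

lemma eq_if_coeff_eq: "f \<in> hset A \<Longrightarrow> g \<in> hset A \<Longrightarrow> (\<And>j. coeff f j = coeff g j) \<Longrightarrow> f = g"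
  using disk_series_fun_eq disk_series_coeff by (metis ext)

text \<open>
  The inequality between arithmetic and geometric means, with the weights placed so that the first
  summand is a series in \<open>z\<close> alone and the second one is a term of the norm.
\<close>
lemma power_coeff_bound:
  assumes "x \<in> Y.V"
  shows "Y.nrm (z ^ j *\<^sub>C x) \<le> (rho n j * ((cmod z)\<^sup>2) ^ j + mu n j * (Y.nrm x)\<^sup>2) / 2"
proof -
  have "0 \<le> (sqrt (rho n j) * cmod z ^ j - sqrt (mu n j) * Y.nrm x)\<^sup>2" by simp
  also have "\<dots> = rho n j * ((cmod z)\<^sup>2) ^ j + mu n j * (Y.nrm x)\<^sup>2
      - 2 * (sqrt (rho n j) * sqrt (mu n j)) * (cmod z ^ j * Y.nrm x)"
    by (simp add: power2_diff power_mult_distrib algebra_simps flip: power_mult)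
  also have "sqrt (rho n j) * sqrt (mu n j) = 1"
    using rho_ge_1[OF n, of j] by (simp add: mu_rho flip: real_sqrt_mult)
  finally show ?thesis
    using assms by (simp add: Y.nrm_scale norm_power)
qed

lemma summable_rho_disk: "z \<in> ball 0 1 \<Longrightarrow> summable (\<lambda>j. rho n j * ((cmod z)\<^sup>2) ^ j)"
  using n by (intro summable_rho_power) (auto simp: power_less_one_iff abs_square_less_1)

lemma disk_series_of_coeffs:
  assumes a: "\<And>j. a j \<in> Y.V" and s: "summable (\<lambda>j. mu n j * (Y.nrm (a j))\<^sup>2)"
  shows "disk_series Y a (of_coeffs Y a)"
  unfolding disk_series_def
proof (intro conjI allI ballI impI)
  fix z :: complex assume z: "z \<in> ball 0 1"
  let ?b = "\<lambda>j. (rho n j * ((cmod z)\<^sup>2) ^ j + mu n j * (Y.nrm (a j))\<^sup>2) / 2"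
  have sb: "summable ?b"
    using summable_rho_disk[OF z] s by (intro summable_divide summable_add)
  obtain l where l: "hconverges Y (\<lambda>N. \<Sum>j<N. z ^ j *\<^sub>C a j) l"
  proof (rule Y.abs_summable_hconverges[of "\<lambda>j. z ^ j *\<^sub>C a j" ?b])
    show "Y.nrm (z ^ j *\<^sub>C a j) \<le> ?b j" for j by (rule power_coeff_bound) (rule a)
  qed (use a sb in simp_all)
  then have "of_coeffs Y a z = l"
    unfolding of_coeffs_def using z a
      Y.hconverges_unique[of "\<lambda>N. \<Sum>j<N. z ^ j *\<^sub>C a j"]
    by (auto intro!: the_equality)
  with l show "hconverges Y (\<lambda>N. \<Sum>j<N. z ^ j *\<^sub>C a j) (of_coeffs Y a z)"
    by simp
qed (auto simp: of_coeffs_def a)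

lemma
  assumes "\<And>j. a j \<in> Y.V" "summable (\<lambda>j. mu n j * (Y.nrm (a j))\<^sup>2)"
  shows of_coeffs_mem: "of_coeffs Y a \<in> hset A"
    and coeff_of_coeffs: "coeff (of_coeffs Y a) = a"
  using disk_series_of_coeffs[OF assms] assms(2) by (auto intro: memI coeff_eq)

lemma
  assumes f: "f \<in> hset A" and g: "g \<in> hset A"
  shows add_closed: "f + g \<in> hset A" and coeff_add: "coeff (f + g) = (\<lambda>j. coeff f j + coeff g j)"
proof -
  have "disk_series Y (\<lambda>j. coeff f j + coeff g j) (f + g)"
    unfolding disk_series_def
  proof (intro conjI allI ballI impI)
    fix z :: complex assume z: "z \<in> ball 0 1"
    have "hconverges Y (\<lambda>N. (\<Sum>j<N. z ^ j *\<^sub>C coeff f j) + (\<Sum>j<N. z ^ j *\<^sub>C coeff g j)) (f z + g z)"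
      using disk_series_coeff[OF f] disk_series_coeff[OF g] f g z
      by (intro Y.hconverges_add) (auto simp: disk_series_def)
    then show "hconverges Y (\<lambda>N. \<Sum>j<N. z ^ j *\<^sub>C (coeff f j + coeff g j)) ((f + g) z)"
      by (simp add: sum.distrib complex_vector.scale_right_distrib)
  qed (use disk_series_coeff[OF f] disk_series_coeff[OF g] f g in \<open>auto simp: disk_series_def\<close>)
  moreover have "summable (\<lambda>j. mu n j * (Y.nrm (coeff f j + coeff g j))\<^sup>2)"
  proof (rule summable_comparison_test_ev)
    have "(Y.nrm (x + y))\<^sup>2 \<le> 2 * (Y.nrm x)\<^sup>2 + 2 * (Y.nrm y)\<^sup>2" if "x \<in> Y.V" "y \<in> Y.V" for x y
      using that zero_le_power2[of "Y.nrm (x - y)"] by (simp only: Y.nrm_sq_add Y.nrm_sq_diff)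
    then have "mu n j * (Y.nrm (coeff f j + coeff g j))\<^sup>2
      \<le> mu n j * (2 * (Y.nrm (coeff f j))\<^sup>2 + 2 * (Y.nrm (coeff g j))\<^sup>2)" for j
      using f g by (intro mult_left_mono) auto
    then show "\<forall>\<^sub>F j in sequentially. norm (mu n j * (Y.nrm (coeff f j + coeff g j))\<^sup>2)
      \<le> 2 * (mu n j * (Y.nrm (coeff f j))\<^sup>2) + 2 * (mu n j * (Y.nrm (coeff g j))\<^sup>2)"
      by (intro always_eventually allI) (simp add: algebra_simps)
  qed (use f g in \<open>auto intro!: summable_add summable_mult summable_coeff\<close>)
  ultimately show "f + g \<in> hset A" "coeff (f + g) = (\<lambda>j. coeff f j + coeff g j)"
    by (auto intro: memI coeff_eq)
qed

lemma
  assumes f: "f \<in> hset A"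
  shows scale_closed: "c *\<^sub>C f \<in> hset A" and coeff_scale: "coeff (c *\<^sub>C f) = (\<lambda>j. c *\<^sub>C coeff f j)"
proof -
  have "disk_series Y (\<lambda>j. c *\<^sub>C coeff f j) (c *\<^sub>C f)"
    unfolding disk_series_def
  proof (intro conjI allI ballI impI)
    fix z :: complex assume z: "z \<in> ball 0 1"
    have "hconverges Y (\<lambda>N. c *\<^sub>C (\<Sum>j<N. z ^ j *\<^sub>C coeff f j)) (c *\<^sub>C f z)"
      using disk_series_coeff[OF f] f z
      by (intro Y.hconverges_scale) (auto simp: disk_series_def)
    then show "hconverges Y (\<lambda>N. \<Sum>j<N. z ^ j *\<^sub>C c *\<^sub>C coeff f j) ((c *\<^sub>C f) z)"
      by (simp add: complex_vector.scale_sum_right scaleC_fun_def mult.commute)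
  qed (use disk_series_coeff[OF f] f in \<open>auto simp: disk_series_def scaleC_fun_def\<close>)
  moreover have "summable (\<lambda>j. mu n j * (Y.nrm (c *\<^sub>C coeff f j))\<^sup>2)"
    using summable_mult[OF summable_coeff[OF f], of "(cmod c)\<^sup>2"] f
    by (simp add: Y.nrm_scale power_mult_distrib mult.left_commute)
  ultimately show "c *\<^sub>C f \<in> hset A" "coeff (c *\<^sub>C f) = (\<lambda>j. c *\<^sub>C coeff f j)"
    by (auto intro: memI coeff_eq)
qed

lemma zero_closed: "0 \<in> hset A" and coeff_zero [simp]: "coeff 0 j = 0"
proof -
  have *: "disk_series Y (\<lambda>_. 0) 0" by (simp add: disk_series_def Y.hconverges_const)
  show "0 \<in> hset A" "coeff 0 j = 0"
    using memI[OF *] coeff_eq[OF *] by auto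
qed

lemma
  assumes f: "f \<in> hset A" and g: "g \<in> hset A"
  shows diff_closed: "f - g \<in> hset A" and coeff_diff: "coeff (f - g) = (\<lambda>j. coeff f j - coeff g j)"
  using add_closed[OF f scale_closed[OF g, of "-1"]] coeff_add[OF f scale_closed[OF g, of "-1"]]
    coeff_scale[OF g, of "-1"] by simp_all

lemma summable_ip:
  assumes f: "f \<in> hset A" and g: "g \<in> hset A"
  shows "summable (\<lambda>j. of_real (mu n j) * Y.ip (coeff f j) (coeff g j))"
proof (rule summable_comparison_test_ev)
  have "norm (of_real (mu n j) * Y.ip (coeff f j) (coeff g j))
      \<le> (mu n j * (Y.nrm (coeff f j))\<^sup>2) + (mu n j * (Y.nrm (coeff g j))\<^sup>2)" for j
  proof -
    have "0 \<le> (Y.nrm (coeff f j))\<^sup>2 + (Y.nrm (coeff g j))\<^sup>2" by simp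
    moreover have "0 \<le> (Y.nrm (coeff f j) - Y.nrm (coeff g j))\<^sup>2" by simp
    ultimately have "cmod (Y.ip (coeff f j) (coeff g j)) \<le> (Y.nrm (coeff f j))\<^sup>2 + (Y.nrm (coeff g j))\<^sup>2"
      using Y.cauchy_schwarz[OF coeff_mem[OF f] coeff_mem[OF g], of j j]
      unfolding power2_diff by linarith
    then show ?thesis
      using mult_left_mono[of _ _ "mu n j"] by (simp add: norm_mult flip: distrib_left)
  qed
  then show "\<forall>\<^sub>F j in sequentially. norm (of_real (mu n j) * Y.ip (coeff f j) (coeff g j))
      \<le> (mu n j * (Y.nrm (coeff f j))\<^sup>2) + (mu n j * (Y.nrm (coeff g j))\<^sup>2)"
    by (intro always_eventually allI)
qed (use f g in \<open>auto intro!: summable_add summable_coeff\<close>)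

lemma ip_eq: "hinner A f g = (\<Sum>j. of_real (mu n j) * Y.ip (coeff f j) (coeff g j))"
  by (simp add: bergman_def)

lemma ip_sums:
  "f \<in> hset A \<Longrightarrow> g \<in> hset A \<Longrightarrow>
    (\<lambda>j. of_real (mu n j) * Y.ip (coeff f j) (coeff g j)) sums hinner A f g"
  unfolding ip_eq by (intro summable_sums summable_ip)

lemma
  assumes f: "f \<in> hset A"
  shows nrm_sums: "(\<lambda>j. mu n j * (Y.nrm (coeff f j))\<^sup>2) sums (hnorm A f)\<^sup>2"
    and hnorm_nonneg: "0 \<le> hnorm A f"
proof -
  have "(\<lambda>j. Re (of_real (mu n j) * Y.ip (coeff f j) (coeff f j))) sums Re (hinner A f f)"
    by (intro sums_Re ip_sums f)
  then have *: "(\<lambda>j. mu n j * (Y.nrm (coeff f j))\<^sup>2) sums Re (hinner A f f)"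
    using f by (simp add: Y.nrm_sq)
  then have "0 \<le> Re (hinner A f f)"
    by (rule sums_le[OF _ sums_zero, rotated]) simp
  with * show "(\<lambda>j. mu n j * (Y.nrm (coeff f j))\<^sup>2) sums (hnorm A f)\<^sup>2" "0 \<le> hnorm A f"
    by (auto simp: hnorm_def)
qed

lemma coeff_bound:
  assumes f: "f \<in> hset A" shows "mu n j * (Y.nrm (coeff f j))\<^sup>2 \<le> (hnorm A f)\<^sup>2"
  using sum_le_suminf[OF summable_coeff[OF f], of "{j}"] nrm_sums[OF f] by (simp add: sums_iff)

lemma coeff_nrm_le:
  assumes f: "f \<in> hset A" shows "Y.nrm (coeff f j) \<le> hnorm A f / sqrt (mu n j)"
proof -
  have "(Y.nrm (coeff f j))\<^sup>2 \<le> (hnorm A f / sqrt (mu n j))\<^sup>2"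
    using coeff_bound[OF f, of j] by (simp add: power_divide pos_le_divide_eq mult.commute)
  then show ?thesis
    by (rule power2_le_imp_le) (simp add: hnorm_nonneg[OF f])
qed

text \<open>
  The usual argument for weighted \<open>\<ell>\<^sup>2\<close>: the coefficients converge one by one, and letting the second
  index of the Cauchy condition tend to infinity in finite partial sums bounds the distance to the
  limit.
\<close>
lemma complete_bergman:
  assumes X: "\<And>k. X k \<in> hset A" and C: "hCauchy A X"
  shows "\<exists>l. hconverges A X l"
proof -
  have "\<exists>a. hconverges Y (\<lambda>k. coeff (X k) j) a" for j
  proof (rule Y.complete)
    show "hCauchy Y (\<lambda>k. coeff (X k) j)"
      unfolding hCauchy_def
    proof (intro allI impI)
      fix e :: real assume "e > 0"
      then have "e * sqrt (mu n j) > 0" by simp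
      then obtain N where N: "\<And>i k. i \<ge> N \<Longrightarrow> k \<ge> N \<Longrightarrow> hnorm A (X i - X k) < e * sqrt (mu n j)"
        using C unfolding hCauchy_def by blast
      have "Y.nrm (coeff (X i) j - coeff (X k) j) < e" if "i \<ge> N" "k \<ge> N" for i k
      proof -
        have "Y.nrm (coeff (X i) j - coeff (X k) j) \<le> hnorm A (X i - X k) / sqrt (mu n j)"
          using coeff_nrm_le[OF diff_closed[OF X X], of i k j] by (simp add: coeff_diff X)
        also have "\<dots> < e"
          using N[OF that] by (simp add: pos_divide_less_eq)
        finally show ?thesis .
      qed
      then show "\<exists>N. \<forall>i\<ge>N. \<forall>k\<ge>N. Y.nrm (coeff (X i) j - coeff (X k) j) < e" by blast
    qed
  qed (use X in auto)
  then obtain a where a: "\<And>j. hconverges Y (\<lambda>k. coeff (X k) j) (a j)"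
    by metis
  then have aV: "a j \<in> Y.V" for j by (simp add: hconverges_def)
  have part: "(\<Sum>j<J. mu n j * (Y.nrm (coeff (X k) j - a j))\<^sup>2) \<le> e\<^sup>2"
    if e: "\<And>l. l \<ge> N \<Longrightarrow> hnorm A (X k - X l) < e" for N k e J
  proof -
    have "(\<lambda>l. \<Sum>j<J. mu n j * (Y.nrm (coeff (X k) j - coeff (X l) j))\<^sup>2)
        \<longlonglongrightarrow> (\<Sum>j<J. mu n j * (Y.nrm (coeff (X k) j - a j))\<^sup>2)"
      using X aV a
      by (intro tendsto_intros Y.tendsto_nrm Y.hconverges_diff Y.hconverges_const) auto
    moreover have "(\<Sum>j<J. mu n j * (Y.nrm (coeff (X k) j - coeff (X l) j))\<^sup>2) \<le> e\<^sup>2" if "l \<ge> N" for l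
    proof -
      have d: "X k - X l \<in> hset A" by (intro diff_closed X)
      have "(\<Sum>j<J. mu n j * (Y.nrm (coeff (X k - X l) j))\<^sup>2) \<le> (hnorm A (X k - X l))\<^sup>2"
        using sum_le_suminf[OF summable_coeff[OF d], of "{..<J}"] nrm_sums[OF d] by (simp add: sums_iff)
      also have "\<dots> \<le> e\<^sup>2"
        using e[OF that] hnorm_nonneg[OF d] by (intro power_mono) auto
      finally show ?thesis by (simp add: coeff_diff X)
    qed
    ultimately show ?thesis
      by (intro LIMSEQ_le_const2) auto
  qed
  have tail: "summable (\<lambda>j. mu n j * (Y.nrm (coeff (X k) j - a j))\<^sup>2) \<and>
      (\<Sum>j. mu n j * (Y.nrm (coeff (X k) j - a j))\<^sup>2) \<le> e\<^sup>2"
    if e: "\<And>l. l \<ge> N \<Longrightarrow> hnorm A (X k - X l) < e" for N k e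
  proof -
    have "summable (\<lambda>j. mu n j * (Y.nrm (coeff (X k) j - a j))\<^sup>2)"
      by (rule summableI_nonneg_bounded[OF _ part[OF e]]) auto
    then show ?thesis
      by (auto intro!: suminf_le_const part[OF e])
  qed
  have D: "coeff (of_coeffs Y (\<lambda>j. coeff (X k) j - a j)) = (\<lambda>j. coeff (X k) j - a j) \<and>
      of_coeffs Y (\<lambda>j. coeff (X k) j - a j) \<in> hset A \<and>
      hnorm A (of_coeffs Y (\<lambda>j. coeff (X k) j - a j)) \<le> e"
    if e: "\<And>l. l \<ge> N \<Longrightarrow> hnorm A (X k - X l) < e" and "k \<ge> N" for N k e
  proof -
    let ?a = "\<lambda>j. coeff (X k) j - a j"
    have c: "coeff (of_coeffs Y ?a) = ?a" and m: "of_coeffs Y ?a \<in> hset A"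
      using coeff_of_coeffs[of ?a] of_coeffs_mem[of ?a] tail[OF e] X aV by auto
    have "(hnorm A (of_coeffs Y ?a))\<^sup>2 \<le> e\<^sup>2"
      using nrm_sums[OF m] tail[OF e] c by (simp add: sums_iff)
    moreover have "e \<ge> 0" using e[OF that(2)] hnorm_nonneg[OF diff_closed[OF X X]]
      by (meson less_eq_real_def order_le_less_trans)
    ultimately show ?thesis using c m power2_le_imp_le by blast
  qed
  obtain N0 where N0: "\<And>i j. i \<ge> N0 \<Longrightarrow> j \<ge> N0 \<Longrightarrow> hnorm A (X i - X j) < 1"
    using C unfolding hCauchy_def by (meson zero_less_one)
  define f where "f = X N0 - of_coeffs Y (\<lambda>j. coeff (X N0) j - a j)"
  have f: "f \<in> hset A" "coeff f = a"
    using D[of N0 N0 1] N0 unfolding f_def by (auto simp: diff_closed X coeff_diff)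
  have "(\<lambda>k. hnorm A (X k - f)) \<longlonglongrightarrow> 0"
  proof (rule LIMSEQ_I)
    fix e :: real assume "e > 0"
    then obtain N where N: "\<And>i j. i \<ge> N \<Longrightarrow> j \<ge> N \<Longrightarrow> hnorm A (X i - X j) < e / 2"
      using C unfolding hCauchy_def by (meson half_gt_zero)
    have "norm (hnorm A (X k - f) - 0) < e" if k: "k \<ge> N" for k
    proof -
      have "X k - f = of_coeffs Y (\<lambda>j. coeff (X k) j - a j)"
        using D[of N k "e/2"] N k by (intro eq_if_coeff_eq) (auto simp: diff_closed X f coeff_diff)
      then show ?thesis
        using D[of N k "e/2"] N k \<open>e > 0\<close> hnorm_nonneg[OF diff_closed[OF X f(1)], of k] by auto
    qed
    then show "\<exists>N. \<forall>k\<ge>N. norm (hnorm A (X k - f) - 0) < e" by blast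
  qed
  then show ?thesis using f by (auto simp: hconverges_def)
qed

lemma hilbert_space_bergman: "hilbert_space A"
  unfolding hilbert_space_def
proof (intro conjI ballI allI impI)
  show "complex_vector.subspace (hset A)"
    by (simp add: complex_vector.subspace_def add_closed scale_closed zero_closed)
  show "hinner A (x + y) z = hinner A x z + hinner A y z"
    if xyz: "x \<in> hset A" "y \<in> hset A" "z \<in> hset A" for x y z
  proof (rule sums_unique2[OF ip_sums[OF add_closed]])
    show "(\<lambda>j. of_real (mu n j) * Y.ip (coeff (x + y) j) (coeff z j)) sums (hinner A x z + hinner A y z)"
      using sums_add[OF ip_sums[OF xyz(1,3)] ip_sums[OF xyz(2,3)]] xyz
      by (simp add: coeff_add distrib_left)
  qed (use xyz in auto)
  show "hinner A (c *\<^sub>C x) y = c * hinner A x y"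
    if xy: "x \<in> hset A" "y \<in> hset A" for x y c
  proof (rule sums_unique2[OF ip_sums[OF scale_closed]])
    show "(\<lambda>j. of_real (mu n j) * Y.ip (coeff (c *\<^sub>C x) j) (coeff y j)) sums (c * hinner A x y)"
      using sums_mult[OF ip_sums[OF xy], of c] xy by (simp add: coeff_scale mult.left_commute)
  qed (use xy in auto)
  show "hinner A y x = cnj (hinner A x y)" if xy: "x \<in> hset A" "y \<in> hset A" for x y
  proof (rule sums_unique2[OF ip_sums])
    have "(\<lambda>j. cnj (of_real (mu n j) * Y.ip (coeff x j) (coeff y j))) sums cnj (hinner A x y)"
      using ip_sums[OF xy] by (simp only: sums_cnj)
    moreover have "cnj (of_real (mu n j) * Y.ip (coeff x j) (coeff y j)) =
        of_real (mu n j) * Y.ip (coeff y j) (coeff x j)" for j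
      using Y.ip_commute[of "coeff x j" "coeff y j"] xy by simp
    ultimately show "(\<lambda>j. of_real (mu n j) * Y.ip (coeff y j) (coeff x j)) sums cnj (hinner A x y)"
      by simp
  qed (use xy in auto)
  show "0 < Re (hinner A x x)" if x: "x \<in> hset A" "x \<noteq> 0" for x
  proof -
    obtain j where "coeff x j \<noteq> 0"
      using eq_if_coeff_eq[OF x(1) zero_closed] x(2) by auto
    then have "0 < mu n j * (Y.nrm (coeff x j))\<^sup>2" 
      using x by simp
    also have "\<dots> \<le> (hnorm A x)\<^sup>2" by (rule coeff_bound[OF x(1)])
    finally have "hnorm A x \<noteq> 0" by auto
    with hnorm_nonneg[OF x(1)] show ?thesis by (simp add: hnorm_def)
  qed
  show "\<exists>l. hconverges A X l" if "(\<forall>k. X k \<in> hset A) \<and> hCauchy A X" for X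
    using complete_bergman that by blast
qed

sublocale A: hilbert "bergman n Y"
  by (rule hilbert.intro, rule hilbert_space_bergman)

text \<open>
  Summing \<open>power_coeff_bound\<close> bounds \<open>\<parallel>f z\<parallel>\<close> on the unit sphere, and homogeneity does the rest.
\<close>
lemma eval_bound:
  assumes z: "z \<in> ball 0 1"
  obtains C where "\<And>f. f \<in> hset A \<Longrightarrow> Y.nrm (f z) \<le> C * A.nrm f"
proof -
  define S where "S = (\<Sum>j. rho n j * ((cmod z)\<^sup>2) ^ j)"
  have S: "Y.nrm (f z) \<le> (S + (A.nrm f)\<^sup>2) / 2" if f: "f \<in> hset A" for f
  proof -
    let ?b = "\<lambda>j. (rho n j * ((cmod z)\<^sup>2) ^ j + mu n j * (Y.nrm (coeff f j))\<^sup>2) / 2"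
    have s: "?b sums ((S + (A.nrm f)\<^sup>2) / 2)"
      unfolding S_def using summable_rho_disk[OF z]
      by (intro sums_divide sums_add nrm_sums f summable_sums)
    obtain l where l: "hconverges Y (\<lambda>N. \<Sum>j<N. z ^ j *\<^sub>C coeff f j) l" "Y.nrm l \<le> suminf ?b"
    proof (rule Y.abs_summable_hconverges[of "\<lambda>j. z ^ j *\<^sub>C coeff f j" ?b])
      show "Y.nrm (z ^ j *\<^sub>C coeff f j) \<le> ?b j" for j by (rule power_coeff_bound) (simp add: f)
    qed (use f sums_summable[OF s] in simp_all)
    have "l = f z"
      using l disk_series_coeff[OF f] z f
      by (intro Y.hconverges_unique[of "\<lambda>N. \<Sum>j<N. z ^ j *\<^sub>C coeff f j"])
        (auto simp: disk_series_def)
    then show ?thesis using l s by (simp add: sums_iff)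
  qed
  have "Y.nrm (f z) \<le> ((S + 1) / 2) * A.nrm f" if f: "f \<in> hset A" for f
  proof (cases "f = 0")
    case True
    then show ?thesis by simp
  next
    case False
    then have p: "A.nrm f > 0" using A.nrm_nonneg[OF f] A.nrm_eq_0[OF f] by linarith
    let ?c = "of_real (1 / A.nrm f) :: complex"
    have "A.nrm (?c *\<^sub>C f) = 1" using p f False by (simp add: A.nrm_scale norm_divide)
    then have "Y.nrm ((?c *\<^sub>C f) z) \<le> (S + 1) / 2"
      using S[of "?c *\<^sub>C f"] f by simp
    moreover have "Y.nrm ((?c *\<^sub>C f) z) = Y.nrm (f z) / A.nrm f"
      using f p by (simp add: scaleC_fun_def Y.nrm_scale norm_divide)
    ultimately show ?thesis using p by (simp only: pos_divide_le_eq)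
  qed
  then show ?thesis using that by blast
qed

lemma
  assumes f: "f \<in> hset A"
  shows shift_closed: "shift f \<in> hset A"
    and coeff_shift_0: "coeff (shift f) 0 = 0"
    and coeff_shift_Suc: "coeff (shift f) (Suc j) = coeff f j"
proof -
  let ?a = "case_nat 0 (coeff f)"
  have aV: "?a j \<in> Y.V" for j using f by (cases j) auto
  have "disk_series Y ?a (shift f)"
    unfolding disk_series_def
  proof (intro conjI allI ballI impI)
    fix z :: complex assume z: "z \<in> ball 0 1"
    have "hconverges Y (\<lambda>N. z *\<^sub>C (\<Sum>j<N. z ^ j *\<^sub>C coeff f j)) (z *\<^sub>C f z)"
      using disk_series_coeff[OF f] f z
      by (intro Y.hconverges_scale) (auto simp: disk_series_def)
    moreover have "(\<Sum>j<Suc N. z ^ j *\<^sub>C ?a j) = z *\<^sub>C (\<Sum>j<N. z ^ j *\<^sub>C coeff f j)" for N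
      by (simp add: sum.lessThan_Suc_shift complex_vector.scale_sum_right del: sum.lessThan_Suc)
    ultimately have "hconverges Y (\<lambda>N. \<Sum>j<Suc N. z ^ j *\<^sub>C ?a j) (z *\<^sub>C f z)"
      by (simp only:)
    then show "hconverges Y (\<lambda>N. \<Sum>j<N. z ^ j *\<^sub>C ?a j) (shift f z)"
      unfolding hconverges_def shift_def by (blast intro: LIMSEQ_imp_Suc)
  next
    fix z :: complex assume z: "z \<notin> ball 0 1"
    then show "shift f z = 0" using disk_series_coeff[OF f] by (simp add: disk_series_def shift_def)
  qed (use aV in simp)
  moreover have "summable (\<lambda>j. mu n j * (Y.nrm (?a j))\<^sup>2)"
  proof -
    have "summable (\<lambda>j. mu n (Suc j) * (Y.nrm (coeff f j))\<^sup>2)"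
      by (rule summable_comparison_test_ev[OF _ summable_coeff[OF f]])
        (auto intro!: always_eventually mult_right_mono mu_antimono)
    then show ?thesis
      by (subst summable_Suc_iff[symmetric]) simp
  qed
  ultimately show "shift f \<in> hset A" "coeff (shift f) 0 = 0" "coeff (shift f) (Suc j) = coeff f j"
    using memI[of ?a] coeff_eq[of ?a] by auto
qed

lemma
  assumes f: "f \<in> hset A"
  shows backshift_closed: "backshift n Y f \<in> hset A"
    and coeff_backshift: "coeff (backshift n Y f) j = of_real (mu n (Suc j) / mu n j) *\<^sub>C coeff f (Suc j)"
proof -
  let ?a = "\<lambda>j. of_real (mu n (Suc j) / mu n j) *\<^sub>C coeff f (Suc j)"
  have "mu n j * (Y.nrm (?a j))\<^sup>2 \<le> mu n (Suc j) * (Y.nrm (coeff f (Suc j)))\<^sup>2" for j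
  proof -
    have "mu n j * (Y.nrm (?a j))\<^sup>2
        = (mu n (Suc j) / mu n j) * (mu n (Suc j) * (Y.nrm (coeff f (Suc j)))\<^sup>2)"
      using f by (simp add: Y.nrm_scale power_mult_distrib power2_eq_square del: of_real_divide)
    also have "\<dots> \<le> 1 * (mu n (Suc j) * (Y.nrm (coeff f (Suc j)))\<^sup>2)"
      by (intro mult_right_mono) (auto simp: mu_antimono)
    finally show ?thesis by simp
  qed
  then have le: "norm (mu n j * (Y.nrm (?a j))\<^sup>2) \<le> mu n (Suc j) * (Y.nrm (coeff f (Suc j)))\<^sup>2" for j
    by (simp only: real_norm_def abs_mult abs_of_nonneg[OF mu_nonneg] abs_power2)
  have "summable (\<lambda>j. mu n j * (Y.nrm (?a j))\<^sup>2)"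
  proof (rule summable_comparison_test_ev)
    show "summable (\<lambda>j. mu n (Suc j) * (Y.nrm (coeff f (Suc j)))\<^sup>2)"
      using summable_coeff[OF f] by (subst summable_Suc_iff)
  qed (intro always_eventually allI le)
  then show "backshift n Y f \<in> hset A" "coeff (backshift n Y f) j = ?a j"
    unfolding backshift_def using of_coeffs_mem[of ?a] coeff_of_coeffs[of ?a] f by auto
qed

lemma ip_shift:
  assumes f: "f \<in> hset A" and g: "g \<in> hset A"
  shows "A.ip (shift f) g = A.ip f (backshift n Y g)"
proof -
  have "(\<lambda>j. of_real (mu n (Suc j)) * Y.ip (coeff f j) (coeff g (Suc j))) sums A.ip (shift f) g"
    using sums_Suc_if_zero[OF ip_sums[OF shift_closed[OF f] g]] f g
    by (simp add: coeff_shift_0 coeff_shift_Suc)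
  moreover have "of_real (mu n (Suc j)) * Y.ip (coeff f j) (coeff g (Suc j)) =
      of_real (mu n j) * Y.ip (coeff f j) (coeff (backshift n Y g) j)" for j
    using f g by (simp add: coeff_backshift)
  ultimately show ?thesis
    using ip_sums[OF f backshift_closed[OF g]] sums_unique2 by (simp only:)
qed

lemma
  assumes f: "f \<in> hset A" and g: "g \<in> hset A"
  shows backshift_add: "backshift n Y (f + g) = backshift n Y f + backshift n Y g"
  using assms by (intro A.eq_if_ip_eq) (simp_all add: backshift_closed shift_closed flip: ip_shift)

lemma
  assumes f: "f \<in> hset A"
  shows backshift_scale: "backshift n Y (c *\<^sub>C f) = c *\<^sub>C backshift n Y f"
  using assms by (intro A.eq_if_ip_eq) (simp_all add: backshift_closed shift_closed flip: ip_shift)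

lemma backshift_pow_closed: "f \<in> hset A \<Longrightarrow> (backshift n Y ^^ k) f \<in> hset A"
  by (induction k) (auto simp: backshift_closed)

lemma coeff_backshift_pow:
  "f \<in> hset A \<Longrightarrow> coeff ((backshift n Y ^^ k) f) j = of_real (mu n (j + k) / mu n j) *\<^sub>C coeff f (j + k)"
proof (induction k arbitrary: j)
  case (Suc k)
  then show ?case
    by (simp add: coeff_backshift backshift_pow_closed flip: of_real_mult del: of_real_divide)
qed auto

text \<open>Since the weights decrease, \<open>\<parallel>B\<^sup>k f\<parallel>\<^sup>2\<close> is at most a tail of the series for \<open>\<parallel>f\<parallel>\<^sup>2\<close>.\<close>
lemma backshift_stable:
  assumes f: "f \<in> hset A" shows "(\<lambda>k. A.nrm ((backshift n Y ^^ k) f)) \<longlonglongrightarrow> 0"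
proof -
  let ?g = "\<lambda>j. mu n j * (Y.nrm (coeff f j))\<^sup>2"
  have "(A.nrm ((backshift n Y ^^ k) f))\<^sup>2 \<le> (\<Sum>j. ?g (j + k))" for k
  proof (rule sums_le[OF _ nrm_sums[OF backshift_pow_closed[OF f]] summable_sums])
    show "mu n j * (Y.nrm (coeff ((backshift n Y ^^ k) f) j))\<^sup>2 \<le> ?g (j + k)" for j
    proof -
      have "mu n j * (Y.nrm (coeff ((backshift n Y ^^ k) f) j))\<^sup>2 = (mu n (j + k) / mu n j) * ?g (j + k)"
        using f by (simp add: coeff_backshift_pow Y.nrm_scale power_mult_distrib power2_eq_square
            del: of_real_divide)
      also have "\<dots> \<le> 1 * ?g (j + k)"
        by (intro mult_right_mono) (auto simp: mu_antimono)
      finally show ?thesis by simp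
    qed
    show "summable (\<lambda>j. ?g (j + k))"
      using summable_coeff[OF f] by (subst summable_iff_shift)
  qed
  moreover have "(\<lambda>k. \<Sum>j. ?g (j + k)) \<longlonglongrightarrow> 0"
  proof -
    have "(\<lambda>k. (\<Sum>j. ?g j) - (\<Sum>j<k. ?g j)) \<longlonglongrightarrow> (\<Sum>j. ?g j) - (\<Sum>j. ?g j)"
      by (intro tendsto_diff tendsto_const summable_LIMSEQ summable_coeff f)
    moreover have "(\<Sum>j. ?g (j + k)) = (\<Sum>j. ?g j) - (\<Sum>j<k. ?g j)" for k
      by (rule suminf_minus_initial_segment) (rule summable_coeff[OF f])
    ultimately show ?thesis by simp
  qed
  ultimately have "(\<lambda>k. (A.nrm ((backshift n Y ^^ k) f))\<^sup>2) \<longlonglongrightarrow> 0"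
    by (intro Lim_null_comparison[of "\<lambda>k. (A.nrm ((backshift n Y ^^ k) f))\<^sup>2" "\<lambda>k. \<Sum>j. ?g (j + k)"]
        always_eventually allI) simp_all
  then have "(\<lambda>k. sqrt ((A.nrm ((backshift n Y ^^ k) f))\<^sup>2)) \<longlonglongrightarrow> sqrt 0"
    by (rule tendsto_real_sqrt)
  then show ?thesis
    by (simp add: hnorm_nonneg backshift_pow_closed f)
qed

text \<open>
  The coefficient at \<open>m\<close> of the form of order \<open>k\<close> is \<open>rho (n - k) m\<close> up to a positive factor; each further
  difference multiplies the generating function \<open>(1 - z)\<^sup>-\<^sup>(\<^sup>n\<^sup>-\<^sup>k\<^sup>)\<close> by \<open>1 - z\<close>.
\<close>
lemma hdiff_backshift_sums:
  assumes "k \<le> n" "f \<in> hset A"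
  shows "(\<lambda>m. (mu n m)\<^sup>2 * rho (n - k) m * (Y.nrm (coeff f m))\<^sup>2) sums
     hdiff k (\<lambda>j. (A.nrm ((backshift n Y ^^ j) f))\<^sup>2)"
  using assms
proof (induction k arbitrary: f)
  case 0
  have "(mu n m)\<^sup>2 * rho n m = mu n m" for m
    using rho_ge_1[OF n, of m] by (simp add: mu_rho power2_eq_square)
  then show ?case
    using nrm_sums[OF 0(2)] by simp
next
  case (Suc k)
  let ?f = "\<lambda>m. (mu n m)\<^sup>2 * rho (n - k) m * (Y.nrm (coeff f m))\<^sup>2"
  \<comment> \<open>At \<open>m = 0\<close> the predecessor truncates; \<open>?g\<close> is only used at successors.\<close>
  let ?g = "\<lambda>m. (mu n m)\<^sup>2 * rho (n - k) (m - 1) * (Y.nrm (coeff f m))\<^sup>2"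
  let ?h = "\<lambda>m. (mu n m)\<^sup>2 * rho (n - Suc k) m * (Y.nrm (coeff f m))\<^sup>2"
  have nk: "n - k = Suc (n - Suc k)" using Suc.prems by simp
  have f: "?f sums hdiff k (\<lambda>j. (A.nrm ((backshift n Y ^^ j) f))\<^sup>2)"
    using Suc by simp
  have "(\<lambda>m. (mu n m)\<^sup>2 * rho (n - k) m * (Y.nrm (coeff (backshift n Y f) m))\<^sup>2) sums
     hdiff k (\<lambda>j. (A.nrm ((backshift n Y ^^ Suc j) f))\<^sup>2)"
    using Suc.IH[of "backshift n Y f"] Suc.prems
    by (simp add: backshift_closed funpow_swap1 del: funpow.simps) (simp add: funpow_swap1)
  moreover have "(mu n m)\<^sup>2 * rho (n - k) m * (Y.nrm (coeff (backshift n Y f) m))\<^sup>2 = ?g (Suc m)" for m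
    using Suc.prems by (simp add: coeff_backshift Y.nrm_scale power_mult_distrib power_divide
        del: of_real_divide)
  ultimately have g: "(\<lambda>m. ?g (Suc m)) sums hdiff k (\<lambda>j. (A.nrm ((backshift n Y ^^ Suc j) f))\<^sup>2)"
    by simp
  have "(\<lambda>m. ?f (Suc m)) sums (hdiff k (\<lambda>j. (A.nrm ((backshift n Y ^^ j) f))\<^sup>2) - ?f 0)"
    using f by (subst sums_Suc_iff) simp
  from sums_diff[OF this g]
  have "(\<lambda>m. ?f (Suc m) - ?g (Suc m)) sums
     (hdiff (Suc k) (\<lambda>j. (A.nrm ((backshift n Y ^^ j) f))\<^sup>2) - ?f 0)"
    by (simp add: hdiff_Suc algebra_simps)
  moreover have "?f (Suc m) - ?g (Suc m) = (mu n (Suc m))\<^sup>2 * rho (n - Suc k) (Suc m) * (Y.nrm (coeff f (Suc m)))\<^sup>2" for m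
    unfolding nk by (simp add: rho_Suc_Suc algebra_simps)
  moreover have "?f 0 = (mu n 0)\<^sup>2 * rho (n - Suc k) 0 * (Y.nrm (coeff f 0))\<^sup>2"
    by simp
  ultimately have "(\<lambda>m. ?h (Suc m)) sums (hdiff (Suc k) (\<lambda>j. (A.nrm ((backshift n Y ^^ j) f))\<^sup>2) - ?h 0)"
    by (simp only:)
  then show ?case
    by (subst (asm) sums_Suc_iff) simp
qed

lemma hdiff_backshift_nonneg:
  "k \<le> n \<Longrightarrow> f \<in> hset A \<Longrightarrow> 0 \<le> hdiff k (\<lambda>j. (A.nrm ((backshift n Y ^^ j) f))\<^sup>2)"
  by (rule sums_le[OF _ sums_zero hdiff_backshift_sums]) auto

lemma backshift_nrm_le: "f \<in> hset A \<Longrightarrow> A.nrm (backshift n Y f) \<le> A.nrm f"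
  using hdiff_backshift_nonneg[of 1 f] n
  by (intro power2_le_imp_le[OF _ hnorm_nonneg]) (auto simp: hdiff_Suc)

definition const :: "'y \<Rightarrow> complex \<Rightarrow> 'y"
  where "const u = of_coeffs Y (\<lambda>j. if j = 0 then u else 0)"

lemma
  assumes u: "u \<in> Y.V"
  shows const_mem: "const u \<in> A.V" and coeff_const: "coeff (const u) j = (if j = 0 then u else 0)"
    and nrm_const: "A.nrm (const u) = Y.nrm u"
proof -
  let ?a = "\<lambda>j :: nat. if j = 0 then u else 0"
  have s: "(\<lambda>j. mu n j * (Y.nrm (?a j))\<^sup>2) sums (Y.nrm u)\<^sup>2"
    using sums_single[of 0 "\<lambda>j. mu n j * (Y.nrm (?a j))\<^sup>2"]
    by (simp add: mu_rho if_distrib if_distribR cong: if_cong)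
  have m: "?a j \<in> Y.V" for j using u by simp
  show c: "const u \<in> A.V" and cc: "coeff (const u) j = ?a j" for j
    using of_coeffs_mem[OF m sums_summable[OF s]] coeff_of_coeffs[OF m sums_summable[OF s]]
    by (auto simp: const_def)
  have "(A.nrm (const u))\<^sup>2 = (Y.nrm u)\<^sup>2"
    using sums_unique2[OF nrm_sums[OF c] ] s by (simp add: cc)
  then show "A.nrm (const u) = Y.nrm u"
    using u c by (simp add: power2_eq_iff_nonneg)
qed

lemma const_add: "u \<in> Y.V \<Longrightarrow> v \<in> Y.V \<Longrightarrow> const (u + v) = const u + const v"
  by (rule eq_if_coeff_eq) (simp_all add: const_mem coeff_const coeff_add)

lemma const_scale: "u \<in> Y.V \<Longrightarrow> const (c *\<^sub>C u) = c *\<^sub>C const u"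
  by (rule eq_if_coeff_eq) (simp_all add: const_mem coeff_const coeff_scale)

lemma shift_pow_mem: "f \<in> A.V \<Longrightarrow> (shift ^^ k) f \<in> A.V"
  by (induction k) (auto simp: shift_closed)

lemma coeff_shift_pow:
  "f \<in> A.V \<Longrightarrow> coeff ((shift ^^ k) f) j = (if j < k then 0 else coeff f (j - k))"
proof (induction k arbitrary: j)
  case (Suc k)
  then show ?case
    by (cases j) (simp_all add: coeff_shift_0 coeff_shift_Suc shift_pow_mem)
qed simp

lemma coeff_sum:
  "(\<And>i. i \<in> I \<Longrightarrow> f i \<in> A.V) \<Longrightarrow> coeff (sum f I) j = (\<Sum>i\<in>I. coeff (f i) j)"
  by (induction I rule: infinite_finite_induct) (simp_all add: coeff_add)

text \<open>
  Polynomials are dense.  Written with powers of the shift, the Taylor polynomials can be pushed through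
  any operator that commutes with the shift.
\<close>
lemma taylor_hconverges:
  assumes f: "f \<in> A.V"
  shows "hconverges A (\<lambda>N. \<Sum>j<N. (shift ^^ j) (const (coeff f j))) f"
proof -
  let ?p = "\<lambda>N. \<Sum>j<N. (shift ^^ j) (const (coeff f j))"
  have m: "(shift ^^ j) (const (coeff f j)) \<in> A.V" for j
    using f by (intro shift_pow_mem const_mem) simp
  have pm: "?p N \<in> A.V" for N using m by simp
  have pc: "coeff (?p N) i = (if i < N then coeff f i else 0)" for N i
  proof -
    have "coeff (?p N) i = (\<Sum>j<N. coeff ((shift ^^ j) (const (coeff f j))) i)"
      using m by (rule coeff_sum)
    also have "\<dots> = (\<Sum>j<N. if j = i then coeff f j else 0)"
      using f by (intro sum.cong refl) (auto simp: coeff_shift_pow const_mem coeff_const)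
    finally show ?thesis by simp
  qed
  let ?g = "\<lambda>j. mu n j * (Y.nrm (coeff f j))\<^sup>2"
  have "(A.nrm (?p N - f))\<^sup>2 = (A.nrm f)\<^sup>2 - (\<Sum>j<N. ?g j)" for N
  proof -
    have d: "?p N - f \<in> A.V" using pm f by simp
    have "(\<lambda>j. ?g j - (if j \<in> {..<N} then ?g j else 0)) sums ((A.nrm f)\<^sup>2 - (\<Sum>j<N. ?g j))"
      by (intro sums_diff nrm_sums f sums_If_finite_set) simp
    moreover have "mu n j * (Y.nrm (coeff (?p N - f) j))\<^sup>2 = ?g j - (if j \<in> {..<N} then ?g j else 0)" for j
      unfolding coeff_diff[OF pm f] pc using f by simp
    ultimately have "(\<lambda>j. mu n j * (Y.nrm (coeff (?p N - f) j))\<^sup>2) sums ((A.nrm f)\<^sup>2 - (\<Sum>j<N. ?g j))"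
      by (simp only:)
    then show ?thesis
      using sums_unique2[OF nrm_sums[OF d]] by blast
  qed
  moreover have "(\<lambda>N. (A.nrm f)\<^sup>2 - (\<Sum>j<N. ?g j)) \<longlonglongrightarrow> (A.nrm f)\<^sup>2 - (A.nrm f)\<^sup>2"
    using nrm_sums[OF f] by (intro tendsto_diff tendsto_const) (simp add: sums_def)
  ultimately have "(\<lambda>N. sqrt ((A.nrm (?p N - f))\<^sup>2)) \<longlonglongrightarrow> sqrt 0"
    by (intro tendsto_real_sqrt) simp
  moreover have "sqrt ((A.nrm (?p N - f))\<^sup>2) = A.nrm (?p N - f)" for N
    by (intro real_sqrt_abs2[THEN trans] | simp add: pm f)+
  ultimately show ?thesis
    using f by (simp add: hconverges_def)
qed

lemma bounded_eval:
  assumes "z \<in> ball 0 1" shows "bounded_operator A Y (\<lambda>f. f z)"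
proof -
  obtain C where "\<And>f. f \<in> A.V \<Longrightarrow> Y.nrm (f z) \<le> C * A.nrm f"
    using eval_bound[OF assms] by blast
  then show ?thesis
    unfolding bounded_operator_def by (auto simp: scaleC_fun_def)
qed

end

lemma shift_pow: "(shift ^^ k) f z = z ^ k *\<^sub>C f z"
  by (induction k) (simp_all add: shift_def mult.commute)

lemma sum_fun_eval: "(\<Sum>i\<in>I. f i) z = (\<Sum>i\<in>I. f i z)"
  by (induction I rule: infinite_finite_induct) simp_all

section \<open>Lifted ranges satisfy the conditions\<close>

text \<open>
  With \<open>W\<close> the multiplication by \<open>\<Theta>\<close>, \<open>N\<close> its kernel and \<open>L\<close> the orthogonal complement of \<open>N\<close>, the lifted
  norm makes \<open>W\<close> a unitary map from \<open>L\<close> onto \<open>M\<close>, by polarization.  For \<open>q \<in> L\<close> the adjoint of the shift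
  sends \<open>W q\<close> to \<open>W (B q)\<close>, so all conditions on \<open>M\<close> become properties of \<open>B\<close> on \<open>L\<close>.
\<close>
lemma lifted_range_imp_conditions:
  assumes "1 \<le> n" "hilbert_space Y" "hilbert_space M" "hilbert_space U"
    and \<Theta>: "contractive_multiplier n U Y \<Theta>" and lift: "is_lifted_range n U \<Theta> M"
  shows "contractively_included M (bergman n Y)" "shift ` hset M \<subseteq> hset M"
    "strongly_stable M (adjoint_op M M shift)" "hypercontraction n M (adjoint_op M M shift)"
proof -
  interpret Y: bergman_space Y n by unfold_locales fact+
  interpret U: bergman_space U n by unfold_locales fact+
  interpret M: hilbert M by unfold_locales fact
  let ?H = "bergman n U" and ?K = "bergman n Y"
  let ?W = "mult_op \<Theta>"
  let ?B = "backshift n U"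
  have W: "bounded_operator ?H ?K ?W" and Wc: "\<And>f. f \<in> U.A.V \<Longrightarrow> Y.A.nrm (?W f) \<le> U.A.nrm f"
    using \<Theta> by (auto simp: contractive_multiplier_def contraction_def)
  note W_add = bounded_operator_add[OF W] and W_scale = bounded_operator_scale[OF W]
    and W_diff = bounded_operator_diff[OF U.hilbert_space_bergman W]
    and W_mem = bounded_operator_mem[OF W]
  have W_shift: "?W (shift f) = shift (?W f)" if "f \<in> U.A.V" for f
  proof
    fix z
    show "?W (shift f) z = shift (?W f) z"
      using \<Theta> that bounded_operator_scale[of U Y "\<Theta> z" "f z" z]
      by (auto simp: mult_op_def shift_def contractive_multiplier_def)
  qed
  define N where "N = kernel_op ?H ?W"
  define L where "L = orth_complement ?H N"
  have N_iff: "x \<in> N \<longleftrightarrow> x \<in> U.A.V \<and> ?W x = 0" for x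
    by (simp add: N_def kernel_op_def)
  have NV: "N \<subseteq> U.A.V" by (auto simp: N_iff)
  have L_iff: "x \<in> L \<longleftrightarrow> x \<in> U.A.V \<and> (\<forall>y\<in>N. U.A.ip x y = 0)" for x
    by (simp add: L_def orth_complement_def)
  have subN: "complex_vector.subspace N"
    using W_diff[of 0 0] by (auto simp: complex_vector.subspace_def N_iff W_add W_scale)
  have subL: "complex_vector.subspace L"
    unfolding L_def by (rule U.A.subspace_orth_complement[OF NV])
  have LV: "x \<in> U.A.V" if "x \<in> L" for x using that by (simp add: L_iff)
  have NL: "U.A.ip x y = 0" if "x \<in> N" "y \<in> L" for x y
    using that U.A.ip_commute[of y x] NV by (auto simp: L_iff)
  have closedN: "l \<in> N" if X: "\<And>k. X k \<in> N" and l: "hconverges ?H X l" for X l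
  proof -
    have XV: "X k \<in> U.A.V" for k using X NV by blast
    have "hconverges ?K (\<lambda>k. ?W (X k)) (?W l)"
      by (rule U.A.hconverges_operator[OF Y.hilbert_space_bergman W XV l])
    then have "hconverges ?K (\<lambda>k. 0) (?W l)"
      using X by (simp add: N_iff)
    then have "?W l = 0"
      using Y.A.hconverges_unique[of "\<lambda>k. 0"] Y.A.hconverges_const[of 0] by simp
    then show ?thesis using l by (simp add: N_iff hconverges_def)
  qed
  have "\<exists>q\<in>L. f - q \<in> N \<and> orth_projection ?H L f = q" if f: "f \<in> U.A.V" for f
  proof -
    obtain p where p: "p \<in> N" "f - p \<in> orth_complement ?H N"
    proof (rule U.A.projection_exists[OF subN NV _ f])
      show "l \<in> N" if "\<And>k. X k \<in> N" "hconverges ?H X l" for X l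
        using closedN[of X l] that by blast
    qed
    then have q: "f - p \<in> L" by (simp add: L_def)
    moreover have "p \<in> orth_complement ?H L"
      using p NV NL by (auto simp: orth_complement_def)
    ultimately have "orth_projection ?H L f = f - p"
      using LV by (intro U.A.orth_projection_eq[OF subL]) auto
    then show ?thesis using p q by auto
  qed
  then obtain P where P: "\<And>f. f \<in> U.A.V \<Longrightarrow> P f \<in> L" "\<And>f. f \<in> U.A.V \<Longrightarrow> f - P f \<in> N"
    "\<And>f. f \<in> U.A.V \<Longrightarrow> orth_projection ?H L f = P f"
    by metis
  have WP: "?W (P f) = ?W f" if "f \<in> U.A.V" for f
    using P(2)[OF that] W_diff[of f "P f"] P(1)[OF that] LV that by (simp add: N_iff)
  have M_eq: "M.V = ?W ` U.A.V" and M_nrm: "\<And>f. f \<in> U.A.V \<Longrightarrow> M.nrm (?W f) = U.A.nrm (P f)"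
    using lift P(3) by (auto simp: is_lifted_range_def Let_def N_def L_def)
  have MW: "?W q \<in> M.V" if "q \<in> L" for q
    using that LV M_eq by blast
  have M_L: "\<exists>q\<in>L. g = ?W q" if "g \<in> M.V" for g
    using that P(1) WP unfolding M_eq by (metis imageE)
  have nrm_L: "M.nrm (?W q) = U.A.nrm q" if q: "q \<in> L" for q
  proof -
    have "orth_projection ?H L q = q"
      using q LV U.A.zero_mem
      by (intro U.A.orth_projection_eq[OF subL]) (auto simp: orth_complement_def)
    then show ?thesis using M_nrm[OF LV[OF q]] P(3)[OF LV[OF q]] by simp
  qed
  have ip_L: "M.ip (?W p) (?W q) = U.A.ip p q" if p: "p \<in> L" and q: "q \<in> L" for p q
  proof -
    have L: "p + q \<in> L" "p - q \<in> L" "p + \<i> *\<^sub>C q \<in> L" "p - \<i> *\<^sub>C q \<in> L"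
      using p q subL by (auto intro: complex_vector.subspace_add complex_vector.subspace_diff
          complex_vector.subspace_scale)
    have "4 * M.ip (?W p) (?W q) = 4 * U.A.ip p q"
      unfolding M.polarization[OF MW[OF p] MW[OF q]] U.A.polarization[OF LV[OF p] LV[OF q]]
      using nrm_L[OF L(1)] nrm_L[OF L(2)] nrm_L[OF L(3)] nrm_L[OF L(4)] LV[OF p] LV[OF q]
      by (simp add: W_add W_diff W_scale)
    then show ?thesis by simp
  qed
  show "contractively_included M ?K"
    unfolding contractively_included_def
  proof (intro conjI ballI)
    show "M.V \<subseteq> Y.A.V" using M_eq W_mem by auto
    fix g assume "g \<in> M.V"
    then obtain q where "q \<in> L" "g = ?W q" using M_L by blast
    then show "Y.A.nrm g \<le> M.nrm g" using nrm_L Wc LV by simp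
  qed
  show "shift ` M.V \<subseteq> M.V"
  proof (rule image_subsetI)
    fix g assume "g \<in> M.V"
    then obtain f where f: "f \<in> U.A.V" "g = ?W f" unfolding M_eq by blast
    then have "shift g = ?W (shift f)" using W_shift by simp
    then show "shift g \<in> M.V" unfolding M_eq using U.shift_closed[OF f(1)] by simp
  qed
  have B_L: "?B q \<in> L" if q: "q \<in> L" for q
  proof -
    have "U.A.ip (?B q) x = 0" if x: "x \<in> N" for x
    proof -
      have xV: "x \<in> U.A.V" and "?W x = 0" using x by (auto simp: N_iff)
      then have "?W (shift x) = 0"
        using W_shift[OF xV] by (simp add: shift_def fun_eq_iff)
      then have "shift x \<in> N" using U.shift_closed[OF xV] by (simp add: N_iff)
      then have "U.A.ip x (?B q) = 0"
        using NL[OF _ q] U.ip_shift[OF xV LV[OF q]] by simp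
      then show ?thesis
        using U.A.ip_commute[OF xV U.backshift_closed[OF LV[OF q]]] by simp
    qed
    then show ?thesis using U.backshift_closed[OF LV[OF q]] by (simp add: L_iff)
  qed
  let ?A = "adjoint_op M M shift"
  \<comment> \<open>\<open>shift p\<close> may leave \<open>L\<close>, but replacing it by its projection \<open>P (shift p)\<close> changes neither its image
    under \<open>W\<close> nor its inner product with \<open>q \<in> L\<close>.\<close>
  have adj: "M.ip (shift h) (?W q) = M.ip h (?W (?B q))" if h: "h \<in> M.V" and q: "q \<in> L" for h q
  proof -
    obtain p where p: "p \<in> L" "h = ?W p" using M_L[OF h] by blast
    have sp: "shift p \<in> U.A.V" using U.shift_closed LV p by blast
    have "M.ip (shift h) (?W q) = M.ip (?W (P (shift p))) (?W q)"
      using p W_shift[of p] LV WP[OF sp] by simp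
    also have "\<dots> = U.A.ip (P (shift p)) q"
      using ip_L P(1)[OF sp] q by simp
    also have "\<dots> = U.A.ip (shift p) q"
      using NL[OF P(2)[OF sp] q] sp P(1)[OF sp] LV q by simp
    also have "\<dots> = U.A.ip p (?B q)"
      using U.ip_shift LV p q by blast
    also have "\<dots> = M.ip h (?W (?B q))"
      using ip_L p B_L[OF q] by simp
    finally show ?thesis .
  qed
  have A_W: "?A (?W q) = ?W (?B q)" if "q \<in> L" for q
    using that MW B_L adj by (intro M.adjoint_unique) auto
  have A_pow: "(?A ^^ k) (?W q) = ?W ((?B ^^ k) q) \<and> (?B ^^ k) q \<in> L" if "q \<in> L" for k q
    by (induction k) (auto simp: A_W B_L that)
  have A: "bounded_operator M M ?A"
    unfolding bounded_operator_def
  proof (intro conjI ballI allI exI[of _ 1])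
    fix x assume "x \<in> M.V"
    then obtain p where p: "p \<in> L" "x = ?W p" using M_L by blast
    show "?A x \<in> M.V" using A_W MW B_L p by auto
    show "?A (c *\<^sub>C x) = c *\<^sub>C ?A x" for c
    proof -
      have "c *\<^sub>C p \<in> L" using p subL by (simp add: complex_vector.subspace_scale)
      from A_W[OF this] show ?thesis
        using p LV[OF p(1)] A_W[OF p(1)] by (simp add: W_scale U.backshift_scale U.backshift_closed)
    qed
    show "M.nrm (?A x) \<le> 1 * M.nrm x"
      using p A_W B_L nrm_L U.backshift_nrm_le LV by simp
    fix y assume "y \<in> M.V"
    then obtain q where q: "q \<in> L" "y = ?W q" using M_L by blast
    have "p + q \<in> L" using p q subL by (simp add: complex_vector.subspace_add)
    from A_W[OF this] show "?A (x + y) = ?A x + ?A y"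
      using p q LV[OF p(1)] LV[OF q(1)] A_W[OF p(1)] A_W[OF q(1)]
      by (simp add: W_add U.backshift_add U.backshift_closed)
  qed
  have nrm_pow: "M.nrm ((?A ^^ k) (?W q)) = U.A.nrm ((?B ^^ k) q)" if "q \<in> L" for q k
    using A_pow[OF that] nrm_L by simp
  show "strongly_stable M ?A"
    unfolding strongly_stable_def
  proof (intro conjI ballI A)
    fix x assume "x \<in> M.V"
    then obtain q where "q \<in> L" "x = ?W q" using M_L by blast
    then show "(\<lambda>k. M.nrm ((?A ^^ k) x)) \<longlonglongrightarrow> 0"
      using nrm_pow U.backshift_stable LV by simp
  qed
  show "hypercontraction n M ?A"
    unfolding M.hypercontraction_iff[OF A]
  proof (intro allI impI ballI)
    fix k x assume "k \<le> n" "x \<in> M.V"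
    then obtain q where "q \<in> L" "x = ?W q" using M_L by blast
    then show "0 \<le> hdiff k (\<lambda>j. (M.nrm ((?A ^^ j) x))\<^sup>2)"
      using nrm_pow U.hdiff_backshift_nonneg[OF \<open>k \<le> n\<close>] LV by simp
  qed
qed

section \<open>Spaces satisfying the conditions are lifted ranges\<close>

text \<open>
  Inclusion in the Bergman space makes the Taylor coefficient functionals of \<open>M\<close> bounded; let \<open>k j v\<close>
  represent \<open>f \<mapsto> \<langle>f\<^sub>j, v\<rangle>\<close>.  Since the shift moves coefficients up by one, \<open>A\<close> provably sends
  \<open>k (Suc j) v\<close> to \<open>k j v\<close> and \<open>k 0 v\<close> to \<open>0\<close>, whatever the definite description returns elsewhere.
  The adjoint of the bounded operator \<open>A\<close> therefore has the same Taylor coefficients as the shift.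
\<close>
lemma adjoint_of_shift:
  assumes "1 \<le> n" "hilbert_space Y" "hilbert_space M"
    and incl: "contractively_included M (bergman n Y)" and inv: "shift ` hset M \<subseteq> hset M"
    and A: "bounded_operator M M (adjoint_op M M shift)"
    and h: "h \<in> hset M" and y: "y \<in> hset M"
  shows "hinner M (shift h) y = hinner M h (adjoint_op M M shift y)"
proof -
  interpret Y: bergman_space Y n by unfold_locales fact+
  interpret M: hilbert M by unfold_locales fact
  let ?A = "adjoint_op M M shift"
  have MK: "f \<in> Y.A.V" "Y.A.nrm f \<le> M.nrm f" if "f \<in> M.V" for f
    using incl that by (auto simp: contractively_included_def)
  have sh: "shift f \<in> M.V" if "f \<in> M.V" for f using inv that by blast
  have "\<exists>k\<in>M.V. \<forall>f\<in>M.V. Y.Y.ip (Y.coeff f j) v = M.ip f k" if v: "v \<in> Y.Y.V" for j v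
  proof -
    have "cmod (Y.Y.ip (Y.coeff f j) v) \<le> (Y.Y.nrm v / sqrt (mu n j)) * M.nrm f" if f: "f \<in> M.V" for f
    proof -
      have "cmod (Y.Y.ip (Y.coeff f j) v) \<le> Y.Y.nrm (Y.coeff f j) * Y.Y.nrm v"
        using MK[OF f] v by (intro Y.Y.cauchy_schwarz) auto
      also have "\<dots> \<le> (Y.A.nrm f / sqrt (mu n j)) * Y.Y.nrm v"
        using MK[OF f] v by (intro mult_right_mono Y.coeff_nrm_le) auto
      also have "\<dots> \<le> (M.nrm f / sqrt (mu n j)) * Y.Y.nrm v"
        using MK[OF f] v by (intro mult_right_mono divide_right_mono) auto
      finally show ?thesis by (simp add: mult.commute)
    qed
    then show ?thesis
      by (rule M.riesz[of "\<lambda>f. Y.Y.ip (Y.coeff f j) v", rotated 2])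
        (use v MK in \<open>auto simp: Y.coeff_add Y.coeff_scale\<close>)
  qed
  then have "\<forall>j v. \<exists>k. v \<in> Y.Y.V \<longrightarrow> k \<in> M.V \<and> (\<forall>f\<in>M.V. Y.Y.ip (Y.coeff f j) v = M.ip f k)"
    by blast
  then obtain k where "\<forall>j v. v \<in> Y.Y.V \<longrightarrow> k j v \<in> M.V \<and> (\<forall>f\<in>M.V. Y.Y.ip (Y.coeff f j) v = M.ip f (k j v))"
    unfolding choice_iff by blast
  then have k: "\<And>j v. v \<in> Y.Y.V \<Longrightarrow> k j v \<in> M.V"
    "\<And>j v f. v \<in> Y.Y.V \<Longrightarrow> f \<in> M.V \<Longrightarrow> Y.Y.ip (Y.coeff f j) v = M.ip f (k j v)"
    by blast+
  have A_Suc: "?A (k (Suc j) v) = k j v" if v: "v \<in> Y.Y.V" for j v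
  proof (rule M.adjoint_unique)
    show "M.ip (shift f) (k (Suc j) v) = M.ip f (k j v)" if f: "f \<in> M.V" for f
      using k(2)[OF v sh[OF f], of "Suc j"] k(2)[OF v f, of j] MK[OF f] by (simp add: Y.coeff_shift_Suc)
  qed (rule k(1)[OF v])
  have A_0: "?A (k 0 v) = 0" if v: "v \<in> Y.Y.V" for v
  proof (rule M.adjoint_unique)
    show "M.ip (shift f) (k 0 v) = M.ip f 0" if f: "f \<in> M.V" for f
      using k(2)[OF v sh[OF f], of 0] MK[OF f] f v by (simp add: Y.coeff_shift_0)
  qed simp
  let ?S = "adjoint_op M M ?A"
  note Sm = bounded_operator_mem[OF M.bounded_adjoint_op[OF A]] and Am = bounded_operator_mem[OF A]
  have S: "M.ip (?S f) g = M.ip f (?A g)" if "f \<in> M.V" "g \<in> M.V" for f g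
    using M.ip_adjoint_op[OF A that(2,1)] that Sm Am by (metis M.ip_commute)
  have "?S h = shift h"
  proof (rule Y.eq_if_coeff_eq)
    fix j
    show "Y.coeff (?S h) j = Y.coeff (shift h) j"
    proof (rule Y.Y.eq_if_ip_eq_left)
      fix v assume v: "v \<in> Y.Y.V"
      have "Y.Y.ip (Y.coeff (?S h) j) v = M.ip h (?A (k j v))"
        using k(2)[OF v Sm[OF h]] S[OF h k(1)[OF v]] by simp
      also have "\<dots> = Y.Y.ip (Y.coeff (shift h) j) v"
        using A_Suc[OF v] A_0[OF v] k(2)[OF v h] MK[OF h] h v
        by (cases j) (simp_all add: Y.coeff_shift_Suc Y.coeff_shift_0)
      finally show "Y.Y.ip (Y.coeff (?S h) j) v = Y.Y.ip (Y.coeff (shift h) j) v" .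
    qed (use MK Sm sh h in auto)
  qed (use MK Sm sh h in auto)
  then show ?thesis using S[OF h y] by simp
qed

text \<open>
  The coefficient space of the multiplier is \<open>M\<close> itself.  The map \<open>Obs\<close> is the observability map of the
  pair \<open>(d, A)\<close>; being an isometry, it satisfies \<open>W (Obs x) = x\<close> for its adjoint \<open>W\<close>, and \<open>Obs \<circ> W\<close> is the
  orthogonal projection onto the complement of the kernel of \<open>W\<close>, which gives the lifted norm.
\<close>
lemma conditions_imp_lifted_range:
  assumes n: "1 \<le> n" and Y: "hilbert_space Y" and M: "hilbert_space M"
    and incl: "contractively_included M (bergman n Y)" and inv: "shift ` hset M \<subseteq> hset M"
    and stable: "strongly_stable M (adjoint_op M M shift)"
    and hyper: "hypercontraction n M (adjoint_op M M shift)"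
  obtains \<Theta> where "contractive_multiplier n M Y \<Theta>" "is_lifted_range n M \<Theta> M"
proof -
  interpret Y: bergman_space Y n by unfold_locales fact+
  interpret M: hilbert M by unfold_locales fact
  interpret U: bergman_space M n by unfold_locales fact+
  let ?H = "bergman n M" and ?K = "bergman n Y"
  let ?A = "adjoint_op M M shift"
  have A: "bounded_operator M M ?A" using stable by (simp add: strongly_stable_def)
  have MK: "f \<in> Y.A.V" "Y.A.nrm f \<le> M.nrm f" if "f \<in> M.V" for f
    using incl that by (auto simp: contractively_included_def)
  have sh: "shift f \<in> M.V" if "f \<in> M.V" for f using inv that by blast
  note adj = adjoint_of_shift[OF n Y M incl inv A]
  note Am = bounded_operator_mem[OF A] and Apm = bounded_operator_mem[OF bounded_operator_pow[OF M A]]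
  have pos: "0 \<le> hdiff k (\<lambda>j. (M.nrm ((?A ^^ j) x))\<^sup>2)" if "k \<le> n" "x \<in> M.V" for k x
    using hyper that by (simp add: M.hypercontraction_iff[OF A])

  obtain d where d: "bounded_operator M M d"
    and d_nrm: "\<And>x. x \<in> M.V \<Longrightarrow> (M.nrm (d x))\<^sup>2 = hdiff n (\<lambda>j. (M.nrm ((?A ^^ j) x))\<^sup>2)"
  proof (rule M.positive_operator_sqrt[OF M.bounded_hyperop[OF A, of n] M.ip_hyperop_symmetric[OF A]])
    show "0 \<le> Re (M.ip (M.hyperop n ?A x) x)" if "x \<in> M.V" for x
      using pos[of n x] that by (simp add: M.ip_hyperop_self[OF A])
  qed (simp_all add: M.ip_hyperop_self[OF A])
  note dm = bounded_operator_mem[OF d]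

  define obs_coeff where "obs_coeff x j = of_real (rho n j) *\<^sub>C d ((?A ^^ j) x)" for x j
  define Obs where "Obs x = of_coeffs M (obs_coeff x)" for x
  have obs_coeff_mem: "obs_coeff x j \<in> M.V" if "x \<in> M.V" for x j
    using that dm Apm by (simp add: obs_coeff_def)
  have obs_coeff_sums: "(\<lambda>j. mu n j * (M.nrm (obs_coeff x j))\<^sup>2) sums (M.nrm x)\<^sup>2" if x: "x \<in> M.V" for x
  proof -
    let ?s = "\<lambda>j. (M.nrm ((?A ^^ j) x))\<^sup>2"
    have "(\<lambda>j. rho n j * hdiff n (\<lambda>i. ?s (i + j))) sums ?s 0"
    proof (rule hdiff_weighted_sums[where n = n])
      show "?s \<longlonglongrightarrow> 0"
        using stable x tendsto_power[of "\<lambda>j. M.nrm ((?A ^^ j) x)" 0 sequentially 2]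
        by (simp add: strongly_stable_def)
      show "0 \<le> hdiff k (\<lambda>i. ?s (i + j))" if "k \<le> n" for k j
        using pos[OF that Apm[OF x], of j] by (simp add: funpow_add)
    qed simp
    moreover have "mu n j * (M.nrm (obs_coeff x j))\<^sup>2 = rho n j * hdiff n (\<lambda>i. ?s (i + j))" for j
    proof -
      have "hdiff n (\<lambda>i. ?s (i + j)) = (M.nrm (d ((?A ^^ j) x)))\<^sup>2"
        using d_nrm[OF Apm[OF x], of j] by (simp add: funpow_add)
      then show ?thesis
        using rho_ge_1[OF n, of j] dm[OF Apm[OF x], of j]
        by (simp add: obs_coeff_def M.nrm_scale power_mult_distrib mu_rho power2_eq_square)
    qed
    ultimately show ?thesis by simp
  qed
  have Obs_mem: "Obs x \<in> U.A.V" if x: "x \<in> M.V" for x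
    unfolding Obs_def by (rule U.of_coeffs_mem[OF obs_coeff_mem[OF x] sums_summable[OF obs_coeff_sums[OF x]]])
  have Obs_coeff: "U.coeff (Obs x) = obs_coeff x" if x: "x \<in> M.V" for x
    unfolding Obs_def by (rule U.coeff_of_coeffs[OF obs_coeff_mem[OF x] sums_summable[OF obs_coeff_sums[OF x]]])
  have Obs_nrm: "U.A.nrm (Obs x) = M.nrm x" if x: "x \<in> M.V" for x
  proof -
    have "(U.A.nrm (Obs x))\<^sup>2 = (M.nrm x)\<^sup>2"
      using U.nrm_sums[OF Obs_mem[OF x]] obs_coeff_sums[OF x] sums_unique2 unfolding Obs_coeff[OF x] by blast
    then show ?thesis
      using x Obs_mem[OF x] by (simp add: power2_eq_iff_nonneg)
  qed
  note Ap = bounded_operator_pow[OF M A]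
  have Obs_add: "Obs (x + y) = Obs x + Obs y" if "x \<in> M.V" "y \<in> M.V" for x y
    by (rule U.eq_if_coeff_eq) (use that in \<open>simp_all add: Obs_mem Obs_coeff U.coeff_add obs_coeff_def
      bounded_operator_add[OF Ap] bounded_operator_add[OF d] Apm complex_vector.scale_right_distrib\<close>)
  have Obs_scale: "Obs (c *\<^sub>C x) = c *\<^sub>C Obs x" if "x \<in> M.V" for x c
    by (rule U.eq_if_coeff_eq) (use that in \<open>simp_all add: Obs_mem Obs_coeff U.coeff_scale obs_coeff_def
      bounded_operator_scale[OF Ap] bounded_operator_scale[OF d] Apm mult.commute\<close>)
  have Obs: "bounded_operator M ?H Obs"
    unfolding bounded_operator_def
    using Obs_mem Obs_add Obs_scale Obs_nrm by (auto intro!: exI[of _ 1])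
  have Obs_ip: "U.A.ip (Obs x) (Obs y) = M.ip x y" if x: "x \<in> M.V" and y: "y \<in> M.V" for x y
  proof -
    have "4 * U.A.ip (Obs x) (Obs y) = 4 * M.ip x y"
      unfolding M.polarization[OF x y] U.A.polarization[OF Obs_mem[OF x] Obs_mem[OF y]]
      using x y by (simp add: Obs_nrm flip: Obs_add Obs_scale bounded_operator_diff[OF M Obs])
    then show ?thesis by simp
  qed
  have Obs_A: "Obs (?A x) = backshift n M (Obs x)" if x: "x \<in> M.V" for x
  proof (rule U.eq_if_coeff_eq)
    fix j
    have "mu n (Suc j) / mu n j * rho n (Suc j) = rho n j"
      using rho_ge_1[OF n, of "Suc j"] by (simp add: mu_rho)
    then show "U.coeff (Obs (?A x)) j = U.coeff (backshift n M (Obs x)) j"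
      using x Am by (simp add: U.coeff_backshift Obs_mem Obs_coeff obs_coeff_def funpow_swap1
          flip: of_real_mult of_real_divide)
  qed (use x Am in \<open>simp_all add: Obs_mem U.backshift_closed\<close>)

  obtain W where W: "bounded_operator ?H M W"
    and W_adj: "\<And>x f. x \<in> M.V \<Longrightarrow> f \<in> U.A.V \<Longrightarrow> U.A.ip (Obs x) f = M.ip x (W f)"
    using adjoint_exists[OF M U.hilbert_space_bergman Obs] by blast
  note Wm = bounded_operator_mem[OF W]
  have W_Ob: "W (Obs x) = x" if x: "x \<in> M.V" for x
    using x W_adj Obs_ip Wm Obs_mem by (intro M.eq_if_ip_eq) (simp_all flip: W_adj)
  have W_le: "M.nrm (W f) \<le> U.A.nrm f" if f: "f \<in> U.A.V" for f
  proof -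
    have "(M.nrm (W f))\<^sup>2 = Re (U.A.ip (Obs (W f)) f)"
      using W_adj[OF Wm[OF f] f] Wm[OF f] by (simp add: M.nrm_sq)
    also have "\<dots> \<le> U.A.nrm (Obs (W f)) * U.A.nrm f"
      using U.A.cauchy_schwarz[OF Obs_mem[OF Wm[OF f]] f] complex_Re_le_cmod order_trans by blast
    finally have "M.nrm (W f) * M.nrm (W f) \<le> M.nrm (W f) * U.A.nrm f"
      using Obs_nrm[OF Wm[OF f]] by (simp add: power2_eq_square)
    then show ?thesis
      using M.nrm_nonneg[OF Wm[OF f]] U.A.nrm_nonneg[OF f]
      by (cases "M.nrm (W f) = 0") (auto simp: mult_le_cancel_left_pos)
  qed
  have W_shift: "W (shift f) = shift (W f)" if f: "f \<in> U.A.V" for f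
  proof (rule M.eq_if_ip_eq)
    fix x assume x: "x \<in> M.V"
    have sf: "shift f \<in> U.A.V" by (rule U.shift_closed[OF f])
    have "M.ip x (W (shift f)) = cnj (U.A.ip (shift f) (Obs x))"
      unfolding W_adj[OF x sf, symmetric] by (rule U.A.ip_commute[OF sf Obs_mem[OF x]])
    also have "\<dots> = cnj (U.A.ip f (Obs (?A x)))"
      using U.ip_shift[OF f Obs_mem[OF x]] Obs_A[OF x] by simp
    also have "\<dots> = M.ip (?A x) (W f)"
      unfolding W_adj[OF Am[OF x] f, symmetric] by (rule U.A.ip_commute[OF f Obs_mem[OF Am[OF x]], symmetric])
    also have "\<dots> = cnj (M.ip (shift (W f)) x)"
      unfolding adj[OF Wm[OF f] x] by (rule M.ip_commute[OF Wm[OF f] Am[OF x]])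
    also have "\<dots> = M.ip x (shift (W f))"
      by (rule M.ip_commute[OF sh[OF Wm[OF f]] x, symmetric])
    finally show "M.ip x (W (shift f)) = M.ip x (shift (W f))" .
  qed (use Wm U.shift_closed sh f in auto)
  have W_shift_pow: "W ((shift ^^ j) f) = (shift ^^ j) (W f)" if "f \<in> U.A.V" for f j
    by (induction j) (simp_all add: W_shift U.shift_pow_mem that)

  define \<Theta> where "\<Theta> z u = W (U.const u) z" for z u
  have M_incl: "bounded_operator M ?K (\<lambda>f. f)"
    unfolding bounded_operator_def using MK by (auto intro!: exI[of _ 1])
  have W_eval: "bounded_operator ?H Y (\<lambda>f. W f z)" if z: "z \<in> ball 0 1" for z
  proof -
    have "bounded_operator ?H ?K W"
      using bounded_operator_compose[OF U.hilbert_space_bergman M W M_incl] .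
    from bounded_operator_compose[OF U.hilbert_space_bergman Y.hilbert_space_bergman this Y.bounded_eval[OF z]]
    show ?thesis .
  qed
  have const_op: "bounded_operator M ?H U.const"
    unfolding bounded_operator_def
    by (auto simp: U.const_mem U.const_add U.const_scale U.nrm_const intro!: exI[of _ 1])
  have \<Theta>: "bounded_operator M Y (\<Theta> z)" if z: "z \<in> ball 0 1" for z
    unfolding \<Theta>_def[abs_def]
    using bounded_operator_compose[OF M U.hilbert_space_bergman const_op W_eval[OF z]] .
  \<comment> \<open>Both sides agree on Taylor polynomials because \<open>W\<close> commutes with the shift.  For the limit,
    \<open>f \<mapsto> W f z\<close> is continuous on the Bergman space and \<open>\<Theta> z\<close> is continuous on \<open>M\<close>.\<close>
  have mult: "mult_op \<Theta> f = W f" if f: "f \<in> U.A.V" for f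
  proof
    fix z
    show "mult_op \<Theta> f z = W f z"
    proof (cases "z \<in> ball 0 1")
      case z: True
      let ?p = "\<lambda>N. \<Sum>j<N. (shift ^^ j) (U.const (U.coeff f j))"
      let ?q = "\<lambda>N. \<Sum>j<N. z ^ j *\<^sub>C U.coeff f j"
      have cm: "U.const (U.coeff f j) \<in> U.A.V" for j using f by (simp add: U.const_mem)
      have pm: "?p N \<in> U.A.V" for N using cm by (simp add: U.shift_pow_mem)
      have qm: "?q N \<in> M.V" for N using f by simp
      have "W (?p N) z = \<Theta> z (?q N)" for N
      proof -
        have "W (?p N) = (\<Sum>j<N. (shift ^^ j) (W (U.const (U.coeff f j))))"
          using cm by (simp add: bounded_operator_sum[OF U.hilbert_space_bergman W] U.shift_pow_mem W_shift_pow)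
        then have "W (?p N) z = (\<Sum>j<N. z ^ j *\<^sub>C \<Theta> z (U.coeff f j))"
          by (simp add: sum_fun_eval shift_pow \<Theta>_def)
        also have "\<dots> = \<Theta> z (?q N)"
          using f by (simp add: bounded_operator_sum[OF M \<Theta>[OF z]] bounded_operator_scale[OF \<Theta>[OF z]])
        finally show ?thesis .
      qed
      moreover have "hconverges Y (\<lambda>N. W (?p N) z) (W f z)"
        by (rule U.A.hconverges_operator[OF Y W_eval[OF z] pm U.taylor_hconverges[OF f]])
      moreover have "hconverges Y (\<lambda>N. \<Theta> z (?q N)) (\<Theta> z (f z))"
        using U.disk_series_coeff[OF f] z
        by (intro M.hconverges_operator[OF Y \<Theta>[OF z] qm]) (simp add: disk_series_def)
      ultimately have "W f z = \<Theta> z (f z)"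
        using bounded_operator_mem[OF \<Theta>[OF z] qm]
        by (intro Y.Y.hconverges_unique[of "\<lambda>N. \<Theta> z (?q N)"]) simp_all
      then show ?thesis using z by (simp add: mult_op_def)
    next
      case False
      then show ?thesis
        using Y.disk_series_coeff[OF MK(1)[OF Wm[OF f]]] by (simp add: mult_op_def disk_series_def)
    qed
  qed
  have "contractive_multiplier n M Y \<Theta>"
    unfolding contractive_multiplier_def contraction_def
  proof (intro conjI ballI \<Theta>)
    show "bounded_operator ?H ?K (mult_op \<Theta>)"
      using bounded_operator_compose[OF U.hilbert_space_bergman M W M_incl]
      by (subst bounded_operator_cong[OF U.hilbert_space_bergman mult])
    fix f assume f: "f \<in> U.A.V"
    show "Y.A.nrm (mult_op \<Theta> f) \<le> U.A.nrm f"
      unfolding mult[OF f] using MK(2)[OF Wm[OF f]] W_le[OF f] by simp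
  qed
  moreover have "is_lifted_range n M \<Theta> M"
    unfolding is_lifted_range_def Let_def
  proof (intro conjI ballI)
    show "M.V = mult_op \<Theta> ` U.A.V"
    proof (intro equalityI subsetI)
      fix x assume "x \<in> M.V"
      then show "x \<in> mult_op \<Theta> ` U.A.V"
        using W_Ob Obs_mem mult by (metis image_eqI)
    qed (use mult Wm in auto)
    fix f assume f: "f \<in> U.A.V"
    let ?N = "kernel_op ?H (mult_op \<Theta>)"
    have N: "x \<in> ?N \<longleftrightarrow> x \<in> U.A.V \<and> W x = 0" for x
      by (auto simp: kernel_op_def mult)
    have fm: "Obs (W f) \<in> U.A.V" using Obs_mem Wm f by simp
    have "orth_projection ?H (orth_complement ?H ?N) f = Obs (W f)"
    proof (rule U.A.orth_projection_eq)
      show "complex_vector.subspace (orth_complement ?H ?N)"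
        by (rule U.A.subspace_orth_complement) (auto simp: N)
      show "orth_complement ?H ?N \<subseteq> U.A.V" by (auto simp: orth_complement_def)
      show "Obs (W f) \<in> orth_complement ?H ?N"
        using fm W_adj[OF Wm[OF f]] Wm[OF f] by (auto simp: orth_complement_def N)
      have "W (f - Obs (W f)) = 0"
        using W_Ob[OF Wm[OF f]] by (simp add: bounded_operator_diff[OF U.hilbert_space_bergman W f fm])
      then have "f - Obs (W f) \<in> ?N" using f fm by (simp add: N)
      moreover have "?N \<subseteq> U.A.V" by (auto simp: N)
      ultimately show "f - Obs (W f) \<in> orth_complement ?H (orth_complement ?H ?N)"
        using U.A.subset_double_orth_complement by blast
    qed
    then show "M.nrm (mult_op \<Theta> f) = U.A.nrm (orth_projection ?H (orth_complement ?H ?N) f)"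
      using Obs_nrm[OF Wm[OF f]] mult[OF f] by simp
  qed
  ultimately show ?thesis by (rule that)
qed

theorem theorem7p3:
  fixes n :: nat
    and Y :: "'y::complex_vector hspace"
    and M :: "(complex \<Rightarrow> 'y) hspace"
  assumes "1 \<le> n" and "hilbert_space Y" and "hilbert_space M"
  shows
    "(contractively_included M (bergman n Y) \<and>
      shift ` hset M \<subseteq> hset M \<and>
      strongly_stable M (adjoint_op M M shift) \<and>
      hypercontraction n M (adjoint_op M M shift)
      \<longleftrightarrow>
      (\<exists>(U :: (complex \<Rightarrow> 'y) hspace) \<Theta>.
         hilbert_space U \<and> contractive_multiplier n U Y \<Theta> \<and> is_lifted_range n U \<Theta> M))
     \<and>
     ((\<exists>(U :: 'u::complex_vector hspace) \<Theta>.
         hilbert_space U \<and> contractive_multiplier n U Y \<Theta> \<and> is_lifted_range n U \<Theta> M)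
      \<longrightarrow>
      contractively_included M (bergman n Y) \<and>
      shift ` hset M \<subseteq> hset M \<and>
      strongly_stable M (adjoint_op M M shift) \<and>
      hypercontraction n M (adjoint_op M M shift))"
    (is "(?C \<longleftrightarrow> _) \<and> _")
proof (intro conjI[OF iffI] impI)
  assume ?C
  then obtain \<Theta> where "contractive_multiplier n M Y \<Theta>" "is_lifted_range n M \<Theta> M"
    using conditions_imp_lifted_range[OF assms] by blast
  with assms(3) show "\<exists>(U :: (complex \<Rightarrow> 'y) hspace) \<Theta>.
      hilbert_space U \<and> contractive_multiplier n U Y \<Theta> \<and> is_lifted_range n U \<Theta> M"
    by blast
next
  assume "\<exists>(U :: (complex \<Rightarrow> 'y) hspace) \<Theta>.
      hilbert_space U \<and> contractive_multiplier n U Y \<Theta> \<and> is_lifted_range n U \<Theta> M"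
  then obtain U :: "(complex \<Rightarrow> 'y) hspace" and \<Theta> where "hilbert_space U"
    "contractive_multiplier n U Y \<Theta>" "is_lifted_range n U \<Theta> M"
    by blast
  from lifted_range_imp_conditions[OF assms this] show ?C
    by (intro conjI)
next
  assume "\<exists>(U :: 'u hspace) \<Theta>.
      hilbert_space U \<and> contractive_multiplier n U Y \<Theta> \<and> is_lifted_range n U \<Theta> M"
  then obtain U :: "'u hspace" and \<Theta> where "hilbert_space U"
    "contractive_multiplier n U Y \<Theta>" "is_lifted_range n U \<Theta> M"
    by blast
  from lifted_range_imp_conditions[OF assms this] show ?C
    by (intro conjI)
qed

end
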